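(* Let $\mathcal E$ be a nest on a complex Banach space $X$ having the $p$-property and let $(\Phi,\Psi)$ be an admissible support function pair on $\mathcal E$. Then $\mathcal M(\Phi,\Psi)=\mathcal M(\Phi)\cap\mathcal M^e(\Psi)$ is a $\mathcal T(\mathcal E)$-bimodule whose support function pair $(\Phi_{\mathcal M(\Phi,\Psi)},\Phi^e_{\mathcal M(\Phi,\Psi)})$ equals $(\Phi,\Psi)$, and it contains every $\mathcal T(\mathcal E)$-bimodule whose support function pair is $(\Phi,\Psi)$.
   Context: A nest $\mathcal E$ on $X$ is a family of closed linear subspaces of $X$, totally ordered by inclusion, containing $\{0\}$ and $X$, closed under arbitrary meets $\wedge$ (intersections) and joins $\vee$ (norm-closed linear spans of unions). For $E\in\mathcal E$, $E_-=\vee\{F\in\mathcal E: F\subsetneq E\}$ and $E_+=\wedge\{F\in\mathcal E: E\subsetneq F\}$. $\mathcal E$ has the $p$-property if (i) for every $N=N_-$ in $\mathcal E$ there is a strictly increasing sequence $(N_k)$ in $\mathcal E$ with $\vee_k N_k=N$, and (ii) for every $N=N_+$ there is a strictly decreasing sequence $(N_k)$ in $\mathcal E$ with $\wedge_kN_k=N$. $\mathcal T(\mathcal E)=\{T\in\mathcal B(X): TE\subseteq E\ \forall E\in\mathcal E\}$; a $\mathcal T(\mathcal E)$-bimodule is a linear subspace $\mathcal J\subseteq\mathcal B(X)$ with $\mathcal T(\mathcal E)\mathcal J,\mathcal J\mathcal T(\mathcal E)\subseteq\mathcal J$. For subspaces $M,L$ ($L$ closed), $M/L=\{m+L:m\in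 M\}$ and $\dim(M/L)$ is its dimension. A support function is an inclusion-preserving map $\mathcal E\to\mathcal E$; it is admissible if for all $N\neq\{0\}$, $\vee_{E\subsetneq N}\Phi(E)=\Phi(N_-)$. $\Phi\le\Theta$ means $\Phi(E)\subseteq\Theta(E)$ for all $E$. $\mathcal E_f=\{N\in\mathcal E: 0<\dim(N/N_-)<\infty\}$. An essential support function is a support function $\Psi$ such that for all $N,N_1,N_2\in\mathcal E$ with $N_1\subseteq N_2$: (a) $\Psi(N)\in\mathcal E_f\Rightarrow\Psi(N)=\Psi(N)_+$; (b) $\dim(N_2/N_1)<\infty\Rightarrow\Psi(N_2)=\Psi(N_1)$. An admissible support function pair is a pair $(\Phi,\Psi)$ with $\Phi$ admissible, $\Phi(\{0\})=\{0\}$, $\Psi$ an essential support function, $\Psi\le\Phi$, and $\Psi(N)\in\mathcal E_f\Rightarrow\Psi(N)\subsetneq\Phi(N)$ for all $N$. $\mathcal M(\Phi)=\{T\in\mathcal B(X): TE\subseteq\Phi(E)\ \forall E\}$; $\mathcal M^e(\Psi)=\{T\in\mathcal B(X): \dim(TN/L)<\infty$ for all $N,L\in\mathcal E$ with $L_+\supsetneq\Psi(N)\}$. The support function pair of a bimodule $\mathcal J$ is $(\Phi_{\mathcal J},\Phi^e_{\mathcal J})$ with $\Phi_{\mathcal J}(E)=[\mathcal JE]$ (norm-closed linear span of $\{Tx:T\in\mathcal J,x\in E\}$) and $\Phi^e_{\mathcal J}(N)=\wedge\{L\in\mathcal E:\dim(TN/L)<\infty\ \forall T\in\mathcal J\}$.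 *)

theory Defs
  imports "HOL-Analysis.Analysis"
begin

class cbanach = banach +
  fixes cscale :: "complex \<Rightarrow> 'a \<Rightarrow> 'a" (infixr "*\<^sub>C" 75)
  assumes cscale_add_right: "a *\<^sub>C (x + y) = a *\<^sub>C x + a *\<^sub>C y"
    and cscale_add_left: "(a + b) *\<^sub>C x = a *\<^sub>C x + b *\<^sub>C x"
    and cscale_cscale: "a *\<^sub>C (b *\<^sub>C x) = (a * b) *\<^sub>C x"
    and cscale_one: "1 *\<^sub>C x = x"
    and cscale_of_real: "complex_of_real r *\<^sub>C x = r *\<^sub>R x"
    and norm_cscale: "norm (a *\<^sub>C x) = cmod a * norm x"

definition csubspace :: "'a::cbanach set \<Rightarrow> bool" where
  "csubspace M \<longleftrightarrow> 0 \<in> M \<and> (\<forall>x\<in>M. \<forall>y\<in>M. x + y \<in> M) \<and> (\<forall>c. \<forall>x\<in>M. c *\<^sub>C x \<in> M)"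

definition closed_csubspace :: "'a::cbanach set \<Rightarrow> bool" where
  "closed_csubspace M \<longleftrightarrow> csubspace M \<and> closed M"

definition cspan :: "'a::cbanach set \<Rightarrow> 'a set" where
  "cspan S = \<Inter>{M. csubspace M \<and> S \<subseteq> M}"

definition join :: "'a::cbanach set set \<Rightarrow> 'a set" where
  "join F = closure (cspan (\<Union>F))"

definition bop :: "('a::cbanach \<Rightarrow> 'a) \<Rightarrow> bool" where
  "bop T \<longleftrightarrow> bounded_linear T \<and> (\<forall>c x. T (c *\<^sub>C x) = c *\<^sub>C T x)"

text \<open>\<open>dim(M/L) < \<infinity>\<close>: the quotient \<open>M/L\<close> is spanned by finitely many cosets.\<close>
definition findim_quot :: "'a::cbanach set \<Rightarrow> 'a set \<Rightarrow> bool" where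
  "findim_quot M L \<longleftrightarrow> (\<exists>B. finite B \<and> B \<subseteq> M \<and> M \<subseteq> {b + l |b l. b \<in> cspan B \<and> l \<in> L})"

definition nest :: "'a::cbanach set set \<Rightarrow> bool" where
  "nest \<E> \<longleftrightarrow> (\<forall>E\<in>\<E>. closed_csubspace E)
     \<and> (\<forall>E\<in>\<E>. \<forall>F\<in>\<E>. E \<subseteq> F \<or> F \<subseteq> E)
     \<and> {0} \<in> \<E> \<and> UNIV \<in> \<E>
     \<and> (\<forall>F. F \<subseteq> \<E> \<longrightarrow> \<Inter>F \<in> \<E>)
     \<and> (\<forall>F. F \<subseteq> \<E> \<longrightarrow> join F \<in> \<E>)"

definition nest_minus :: "'a::cbanach set set \<Rightarrow> 'a set \<Rightarrow> 'a set" where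
  "nest_minus \<E> E = join {F\<in>\<E>. F \<subset> E}"

definition nest_plus :: "'a::cbanach set set \<Rightarrow> 'a set \<Rightarrow> 'a set" where
  "nest_plus \<E> E = \<Inter>{F\<in>\<E>. E \<subset> F}"

definition p_property :: "'a::cbanach set set \<Rightarrow> bool" where
  "p_property \<E> \<longleftrightarrow>
     (\<forall>N\<in>\<E>. N \<noteq> {0} \<and> N = nest_minus \<E> N \<longrightarrow>
        (\<exists>Ns::nat \<Rightarrow> 'a set. (\<forall>k. Ns k \<in> \<E>) \<and> (\<forall>k. Ns k \<subset> Ns (Suc k)) \<and> join (range Ns) = N))
   \<and> (\<forall>N\<in>\<E>. N \<noteq> UNIV \<and> N = nest_plus \<E> N \<longrightarrow>
        (\<exists>Ns::nat \<Rightarrow> 'a set. (\<forall>k. Ns k \<in> \<E>) \<and> (\<forall>k. Ns (Suc k) \<subset> Ns k) \<and> \<Inter>(range Ns) = N))"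

definition nest_f :: "'a::cbanach set set \<Rightarrow> 'a set set" where
  "nest_f \<E> = {N\<in>\<E>. nest_minus \<E> N \<subset> N \<and> findim_quot N (nest_minus \<E> N)}"

definition support_function :: "'a::cbanach set set \<Rightarrow> ('a set \<Rightarrow> 'a set) \<Rightarrow> bool" where
  "support_function \<E> \<Phi> \<longleftrightarrow> (\<forall>E\<in>\<E>. \<Phi> E \<in> \<E>) \<and> (\<forall>E\<in>\<E>. \<forall>F\<in>\<E>. E \<subseteq> F \<longrightarrow> \<Phi> E \<subseteq> \<Phi> F)"

definition admissible :: "'a::cbanach set set \<Rightarrow> ('a set \<Rightarrow> 'a set) \<Rightarrow> bool" where
  "admissible \<E> \<Phi> \<longleftrightarrow> support_function \<E> \<Phi> \<and>
     (\<forall>N\<in>\<E>. N \<noteq> {0} \<longrightarrow> join (\<Phi> ` {E\<in>\<E>. E \<subset> N}) = \<Phi> (nest_minus \<E> N))"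

definition essential_support_function :: "'a::cbanach set set \<Rightarrow> ('a set \<Rightarrow> 'a set) \<Rightarrow> bool" where
  "essential_support_function \<E> \<Psi> \<longleftrightarrow> support_function \<E> \<Psi> \<and>
     (\<forall>N\<in>\<E>. \<Psi> N \<in> nest_f \<E> \<longrightarrow> \<Psi> N = nest_plus \<E> (\<Psi> N)) \<and>
     (\<forall>N1\<in>\<E>. \<forall>N2\<in>\<E>. N1 \<subseteq> N2 \<and> findim_quot N2 N1 \<longrightarrow> \<Psi> N2 = \<Psi> N1)"

definition admissible_pair ::
  "'a::cbanach set set \<Rightarrow> ('a set \<Rightarrow> 'a set) \<Rightarrow> ('a set \<Rightarrow> 'a set) \<Rightarrow> bool" where
  "admissible_pair \<E> \<Phi> \<Psi> \<longleftrightarrow> admissible \<E> \<Phi> \<and> \<Phi> {0} = {0} \<and>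
     essential_support_function \<E> \<Psi> \<and> (\<forall>E\<in>\<E>. \<Psi> E \<subseteq> \<Phi> E) \<and>
     (\<forall>N\<in>\<E>. \<Psi> N \<in> nest_f \<E> \<longrightarrow> \<Psi> N \<subset> \<Phi> N)"

definition nest_alg :: "'a::cbanach set set \<Rightarrow> ('a \<Rightarrow> 'a) set" where
  "nest_alg \<E> = {T. bop T \<and> (\<forall>E\<in>\<E>. T ` E \<subseteq> E)}"

definition bimodule :: "'a::cbanach set set \<Rightarrow> ('a \<Rightarrow> 'a) set \<Rightarrow> bool" where
  "bimodule \<E> J \<longleftrightarrow> (\<forall>T\<in>J. bop T) \<and> (\<lambda>x. 0) \<in> J
     \<and> (\<forall>S\<in>J. \<forall>T\<in>J. (\<lambda>x. S x + T x) \<in> J) \<and> (\<forall>c. \<forall>T\<in>J. (\<lambda>x. c *\<^sub>C T x) \<in> J)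
     \<and> (\<forall>A\<in>nest_alg \<E>. \<forall>T\<in>J. A \<circ> T \<in> J \<and> T \<circ> A \<in> J)"

definition M_Phi :: "'a::cbanach set set \<Rightarrow> ('a set \<Rightarrow> 'a set) \<Rightarrow> ('a \<Rightarrow> 'a) set" where
  "M_Phi \<E> \<Phi> = {T. bop T \<and> (\<forall>E\<in>\<E>. T ` E \<subseteq> \<Phi> E)}"

definition M_e :: "'a::cbanach set set \<Rightarrow> ('a set \<Rightarrow> 'a set) \<Rightarrow> ('a \<Rightarrow> 'a) set" where
  "M_e \<E> \<Psi> = {T. bop T \<and> (\<forall>N\<in>\<E>. \<forall>L\<in>\<E>. \<Psi> N \<subset> nest_plus \<E> L \<longrightarrow> findim_quot (T ` N) L)}"

definition supp_J :: "('a::cbanach \<Rightarrow> 'a) set \<Rightarrow> 'a set \<Rightarrow> 'a set" where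
  "supp_J J E = closure (cspan {T x |T x. T \<in> J \<and> x \<in> E})"

definition supp_e_J :: "'a::cbanach set set \<Rightarrow> ('a \<Rightarrow> 'a) set \<Rightarrow> 'a set \<Rightarrow> 'a set" where
  "supp_e_J \<E> J N = \<Inter>{L\<in>\<E>. \<forall>T\<in>J. findim_quot (T ` N) L}"

end

theory Submission
  imports Defs
begin

text \<open>The inclusions that need an idea are those asserting that the bimodule is large. For
  \<open>\<Phi>\<close>, rank one operators \<open>f \<otimes> x\<close> suffice. For \<open>\<Psi>\<close>, given \<open>L \<subset> P = \<Psi> N\<close>, one needs an operator
  \<open>T = \<Sum>k. c k (f k \<otimes> x k)\<close> of the bimodule with \<open>dim (T N / L) = \<infinity>\<close>. The \<open>f k\<close> are concentrated
  at the infimum \<open>N0\<close> of all \<open>E\<close> with \<open>P \<subseteq> \<Psi> E\<close>, so that all but finitely many vanish on each \<open>E\<close> with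
  \<open>\<not> P \<subseteq> \<Psi> E\<close>; the \<open>x k\<close> lie in \<open>P\<close>, or tend to \<open>P\<close> from above when \<open>P/P\<^sub>-\<close> is finite dimensional.
  A lower triangular choice of the \<open>f k\<close> against points \<open>y k\<close> of \<open>N\<close> puts every \<open>x k\<close> into \<open>T N\<close>.
  Functionals come from the Hahn-Banach theorem, proved via minimal sublinear functionals.\<close>

section \<open>The Hahn-Banach theorem\<close>

text \<open>The two requirements of \<open>M_e\<close> fix the shape of the series. If
  \<open>\<not> P \<subseteq> \<Psi> E\<close>, the \<open>x k\<close> need not lie in the relevant
  \<open>K\<close>, so \<open>T\<close> must have finite rank on \<open>E\<close>; for the other
  \<open>E\<close> all that is known is \<open>P \<subset> nest_plus \<E> K\<close>, so almost all
  \<open>x k\<close> must lie in \<open>K\<close>. Each hypothesis answers one obstacle. A series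
  needs limits in the nest to be reached by sequences: the p-property. If \<open>N0\<close> is a
  limit from below, only the ranges \<open>\<Phi> E\<close> with \<open>E \<subset> N0\<close> are
  available, and admissibility makes them fill \<open>\<Phi> N0\<close>. If \<open>N0\<close> has an
  immediate predecessor, infinitely many triangular functionals need an infinite dimensional gap,
  which the constancy of \<open>\<Psi>\<close> along finite dimensional quotients provides. If
  \<open>P\<close> is in \<open>nest_f \<E>\<close>, then \<open>P/L\<close> may be finite
  dimensional and the \<open>x k\<close> have to be found above \<open>P\<close>; there is room
  because \<open>P\<close> is then a limit from above and \<open>P \<subset> \<Phi> E\<close>
  whenever \<open>P \<subseteq> \<Psi> E\<close>.\<close>

definition sublinear :: "('a::real_normed_vector \<Rightarrow> real) \<Rightarrow> bool" where
  "sublinear q \<longleftrightarrow> (\<forall>x y. q (x + y) \<le> q x + q y) \<and> (\<forall>r>0. \<forall>x. q (r *\<^sub>R x) \<le> r * q x)"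

lemma sublinear_add: "sublinear q \<Longrightarrow> q (x + y) \<le> q x + q y"
  by (simp add: sublinear_def)

text \<open>The converse inequality is the assumed one applied to \<open>1 / r\<close>. Asking only
  for \<open>\<le>\<close> in the definition is convenient because that passes directly to
  infima.\<close>

lemma sublinear_scaleR:
  assumes "sublinear q" and "r > 0"
  shows "q (r *\<^sub>R x) = r * q x"
proof -
  have "q ((1 / r) *\<^sub>R (r *\<^sub>R x)) \<le> (1 / r) * q (r *\<^sub>R x)"
    using assms unfolding sublinear_def by (metis zero_less_divide_1_iff)
  then have "r * q x \<le> q (r *\<^sub>R x)"
    using \<open>r > 0\<close> by (simp add: field_simps)
  then show ?thesis
    using assms by (auto simp: sublinear_def intro: antisym)
qed

lemma sublinear_0: "sublinear q \<Longrightarrow> q 0 = 0"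
  using sublinear_scaleR[of q 2 0] by simp

lemma sublinear_lower_bound: "sublinear q \<Longrightarrow> - q (- x) \<le> q x"
  using sublinear_add[of q x "- x"] sublinear_0[of q] by simp

text \<open>Makes a sublinear functional additive in the direction \<open>y\<close> without leaving the sublinear ones
  below it.\<close>

definition sublinear_lower :: "('a::real_normed_vector \<Rightarrow> real) \<Rightarrow> 'a \<Rightarrow> 'a \<Rightarrow> real" where
  "sublinear_lower q y x = (INF t\<in>{0..}. q (x + t *\<^sub>R y) - t * q y)"

lemma sublinear_lower_le:
  assumes q: "sublinear q" and "t \<ge> 0"
  shows "sublinear_lower q y x \<le> q (x + t *\<^sub>R y) - t * q y"
  unfolding sublinear_lower_def
proof (rule cINF_lower)
  \<comment> \<open>Finiteness of the infimum: \<open>t * q y\<close> is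
    \<open>q (t *\<^sub>R y)\<close> by homogeneity, and this is at most
    \<open>q (x + t *\<^sub>R y) + q (- x)\<close>.\<close>
  have "- q (- x) \<le> q (x + t *\<^sub>R y) - t * q y" if "t \<ge> 0" for t
  proof (cases "t = 0")
    case True
    then show ?thesis
      using sublinear_lower_bound[OF q] by simp
  next
    case False
    then have "q (t *\<^sub>R y) = t * q y"
      using sublinear_scaleR[OF q] that by simp
    then show ?thesis
      using sublinear_add[OF q, of "x + t *\<^sub>R y" "- x"] by simp
  qed
  then show "bdd_below ((\<lambda>t. q (x + t *\<^sub>R y) - t * q y) ` {0..})"
    by (intro bdd_belowI2) auto
qed (use assms in auto)

lemma sublinear_lower_greatest:
  assumes "\<And>t. t \<ge> 0 \<Longrightarrow> m \<le> q (x + t *\<^sub>R y) - t * q y"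
  shows "m \<le> sublinear_lower q y x"
  unfolding sublinear_lower_def using assms by (intro cINF_greatest) auto

text \<open>Parameters \<open>s\<close> for \<open>x\<close> and \<open>t\<close> for
  \<open>z\<close> add up to the parameter \<open>s + t\<close> for \<open>x + z\<close>, and
  \<open>t\<close> for \<open>x\<close> becomes \<open>r * t\<close> for
  \<open>r *\<^sub>R x\<close>. The infima are taken one variable at a time.\<close>

lemma sublinear_sublinear_lower:
  assumes q: "sublinear q"
  shows "sublinear (sublinear_lower q y)"
  unfolding sublinear_def
proof safe
  fix x z
  have "sublinear_lower q y (x + z) - (q (x + s *\<^sub>R y) - s * q y) \<le> sublinear_lower q y z"
    if "s \<ge> 0" for s
  proof (rule sublinear_lower_greatest)
    fix t :: real assume "t \<ge> 0"
    then have "sublinear_lower q y (x + z) \<le> q (x + z + (s + t) *\<^sub>R y) - (s + t) * q y"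
      using that by (intro sublinear_lower_le[OF q]) auto
    moreover have "q (x + z + (s + t) *\<^sub>R y) \<le> q (x + s *\<^sub>R y) + q (z + t *\<^sub>R y)"
      using sublinear_add[OF q, of "x + s *\<^sub>R y" "z + t *\<^sub>R y"] by (simp add: algebra_simps)
    ultimately show "sublinear_lower q y (x + z) - (q (x + s *\<^sub>R y) - s * q y)
        \<le> q (z + t *\<^sub>R y) - t * q y"
      by (simp add: algebra_simps)
  qed
  then have "sublinear_lower q y (x + z) - sublinear_lower q y z \<le> sublinear_lower q y x"
    by (intro sublinear_lower_greatest) (simp add: algebra_simps)
  then show "sublinear_lower q y (x + z) \<le> sublinear_lower q y x + sublinear_lower q y z"
    by simp
next
  fix r :: real and x assume "r > 0"
  have "sublinear_lower q y (r *\<^sub>R x) / r \<le> sublinear_lower q y x"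
  proof (rule sublinear_lower_greatest)
    fix t :: real assume "t \<ge> 0"
    then have "sublinear_lower q y (r *\<^sub>R x) \<le> q (r *\<^sub>R x + (r * t) *\<^sub>R y) - (r * t) * q y"
      using \<open>r > 0\<close> by (intro sublinear_lower_le[OF q]) auto
    also have "\<dots> = r * (q (x + t *\<^sub>R y) - t * q y)"
      using sublinear_scaleR[OF q \<open>r > 0\<close>, of "x + t *\<^sub>R y"] by (simp add: algebra_simps)
    finally show "sublinear_lower q y (r *\<^sub>R x) / r \<le> q (x + t *\<^sub>R y) - t * q y"
      using \<open>r > 0\<close> by (simp add: field_simps)
  qed
  then show "sublinear_lower q y (r *\<^sub>R x) \<le> r * sublinear_lower q y x"
    using \<open>r > 0\<close> by (simp add: field_simps)
qed

text \<open>Zorn's lemma with the order reversed. The pointwise infimum of a chain is bounded below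
  by \<open>- p (- x)\<close>, and it is subadditive because two members of the chain, used for
  \<open>x\<close> and \<open>y\<close>, may be replaced by the smaller one.\<close>

lemma minimal_sublinear_exists:
  fixes p :: "'a::real_normed_vector \<Rightarrow> real"
  assumes p: "sublinear p"
  shows "\<exists>q. sublinear q \<and> q \<le> p \<and> (\<forall>q'. sublinear q' \<longrightarrow> q' \<le> q \<longrightarrow> q' = q)"
proof -
  define A where "A = {q. sublinear q \<and> q \<le> p}"
  have "\<exists>q\<in>A. \<forall>q'\<in>A. q' \<le> q \<longrightarrow> q' = q"
  proof (rule predicate_Zorn)
    show "partial_order_on A (relation_of (\<lambda>q q'. q' \<le> q) A)"
      by (auto simp: partial_order_on_relation_ofI)
  next
    fix C assume "C \<in> Chains (relation_of (\<lambda>q q'. q' \<le> q) A)"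
    then have CA: "C \<subseteq> A" and chain: "\<And>q q'. q \<in> C \<Longrightarrow> q' \<in> C \<Longrightarrow> q \<le> q' \<or> q' \<le> q"
      by (auto simp: Chains_def relation_of_def)
    show "\<exists>u\<in>A. \<forall>q\<in>C. u \<le> q"
    proof (cases "C = {}")
      case True
      then show ?thesis
        using p by (auto simp: A_def)
    next
      case False
      define u where "u x = (INF q\<in>C. q x)" for x
      have u_le: "u x \<le> q x" if "q \<in> C" for q x
        unfolding u_def
      proof (rule cINF_lower)
        have "- p (- x) \<le> q x" if "q \<in> C" for q
        proof -
          have "sublinear q" and "q (- x) \<le> p (- x)"
            using that CA by (auto simp: A_def le_fun_def)
          then show ?thesis
            using sublinear_lower_bound[of q x] by linarith
        qed
        then show "bdd_below ((\<lambda>q. q x) ` C)"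
          by (intro bdd_belowI2)
      qed fact
      have u_greatest: "m \<le> u x" if "\<And>q. q \<in> C \<Longrightarrow> m \<le> q x" for m x
        unfolding u_def using that False by (intro cINF_greatest) auto
      have "sublinear u"
        unfolding sublinear_def
      proof safe
        fix x y
        have "u (x + y) - q x \<le> u y" if q: "q \<in> C" for q
        proof (rule u_greatest)
          fix q' assume q': "q' \<in> C"
          have "\<exists>r\<in>C. r \<le> q \<and> r \<le> q'"
            using chain[OF q q'] q q' by auto
          then obtain r where r: "r \<in> C" "r \<le> q" "r \<le> q'"
            by auto
          then have "r (x + y) \<le> r x + r y"
            using CA by (auto simp: A_def sublinear_def)
          then show "u (x + y) - q x \<le> q' y"
            using u_le[OF r(1), of "x + y"] le_funD[OF r(2), of x] le_funD[OF r(3), of y] by linarith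
        qed
        then have "u (x + y) - u y \<le> u x"
          by (intro u_greatest) (simp add: algebra_simps)
        then show "u (x + y) \<le> u x + u y"
          by simp
      next
        fix r :: real and x assume "r > 0"
        have "u (r *\<^sub>R x) / r \<le> u x"
        proof (rule u_greatest)
          fix q assume q: "q \<in> C"
          then have "q (r *\<^sub>R x) \<le> r * q x"
            using CA \<open>r > 0\<close> by (auto simp: A_def sublinear_def)
          then show "u (r *\<^sub>R x) / r \<le> q x"
            using u_le[OF q, of "r *\<^sub>R x"] \<open>r > 0\<close> by (simp add: field_simps)
        qed
        then show "u (r *\<^sub>R x) \<le> r * u x"
          using \<open>r > 0\<close> by (simp add: field_simps)
      qed
      moreover have "u \<le> p"
      proof -
        obtain q where "q \<in> C"
          using False by auto
        then show ?thesis
          using u_le CA unfolding A_def le_fun_def by (force intro: order_trans)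
      qed
      ultimately show ?thesis
        using u_le by (auto simp: A_def le_fun_def)
    qed
  qed
  then show ?thesis
    unfolding A_def by (metis (mono_tags, lifting) mem_Collect_eq order_trans)
qed

text \<open>Minimality forces \<open>sublinear_lower q y = q\<close>, and the bound at
  \<open>t = 1\<close> is then the missing superadditivity.\<close>

lemma minimal_sublinear_linear:
  assumes q: "sublinear q" and min: "\<And>q'. sublinear q' \<Longrightarrow> q' \<le> q \<Longrightarrow> q' = q"
  shows "linear q"
proof -
  have "sublinear_lower q y = q" for y
    using sublinear_lower_le[OF q, of 0]
    by (intro min sublinear_sublinear_lower[OF q]) (auto simp: le_fun_def)
  then have "q x \<le> q (x + y) - q y" for x y
    using sublinear_lower_le[OF q, of 1 y x] by simp
  then have add: "q (x + y) = q x + q y" for x y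
    using sublinear_add[OF q, of x y] by (smt (verit))
  have neg: "q (- x) = - q x" for x
    using add[of x "- x"] sublinear_0[OF q] by simp
  have "q (r *\<^sub>R x) = r * q x" for r x
  proof (cases r "0::real" rule: linorder_cases)
    case less
    then have "q ((- r) *\<^sub>R x) = (- r) * q x"
      by (intro sublinear_scaleR[OF q]) auto
    then show ?thesis
      using neg[of "r *\<^sub>R x"] by simp
  qed (use sublinear_0[OF q] sublinear_scaleR[OF q] in auto)
  with add show ?thesis
    by (intro linearI) auto
qed

text \<open>Minimizing below \<open>sublinear_lower p x\<close> instead of \<open>p\<close> pins the
  value at \<open>x\<close>: at \<open>- x\<close>, the choice \<open>t = 1\<close> bounds it by
  \<open>p 0 - p x = - p x\<close>, so \<open>g x \<ge> p x\<close> by linearity.\<close>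

lemma sublinear_dominates_linear:
  fixes p :: "'a::real_normed_vector \<Rightarrow> real"
  assumes p: "sublinear p"
  shows "\<exists>g. linear g \<and> g \<le> p \<and> g x = p x"
proof -
  obtain g where g: "sublinear g" "g \<le> sublinear_lower p x"
    and "\<forall>q'. sublinear q' \<longrightarrow> q' \<le> g \<longrightarrow> q' = g"
    using minimal_sublinear_exists[OF sublinear_sublinear_lower[OF p]] by blast
  then have lin: "linear g"
    using minimal_sublinear_linear by blast
  have "g y \<le> p y" for y
    using g(2) sublinear_lower_le[OF p, of 0 x y] by (force simp: le_fun_def intro: order_trans)
  moreover have "g (- x) \<le> - p x"
    using le_funD[OF g(2), of "- x"] sublinear_lower_le[OF p, of 1 x "- x"] sublinear_0[OF p] by simp
  ultimately show ?thesis
    using lin by (auto simp: le_fun_def linear_neg intro!: exI[of _ g] antisym)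
qed

section \<open>Separation from a closed subspace by means of the distance functional\<close>

lemma sublinear_infdist:
  fixes M :: "'a::real_normed_vector set"
  assumes "subspace M"
  shows "sublinear (\<lambda>x. infdist x M)"
proof -
  have ne: "M \<noteq> {}"
    using assms subspace_0 by blast
  have greatest: "c \<le> infdist x M" if "\<And>m. m \<in> M \<Longrightarrow> c \<le> norm (x - m)" for c x
    using that ne by (auto simp: infdist_def dist_norm intro!: cINF_greatest)
  have le: "infdist x M \<le> norm (x - m)" if "m \<in> M" for m x
    using infdist_le[OF that, of x] by (simp add: dist_norm)
  show ?thesis
    unfolding sublinear_def
  proof safe
    fix x y :: 'a
    have "infdist (x + y) M - norm (x - m) \<le> infdist y M" if m: "m \<in> M" for m
    proof (rule greatest)
      fix n assume "n \<in> M"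
      then have "infdist (x + y) M \<le> norm (x + y - (m + n))"
        using m assms by (intro le) (auto intro: subspace_add)
      also have "\<dots> \<le> norm (x - m) + norm (y - n)"
        using norm_triangle_ineq[of "x - m" "y - n"] by (simp add: algebra_simps)
      finally show "infdist (x + y) M - norm (x - m) \<le> norm (y - n)"
        by simp
    qed
    then have "infdist (x + y) M - infdist y M \<le> infdist x M"
      by (intro greatest) (simp add: algebra_simps)
    then show "infdist (x + y) M \<le> infdist x M + infdist y M"
      by simp
  next
    fix r :: real and x :: 'a assume "r > 0"
    have "infdist (r *\<^sub>R x) M / r \<le> infdist x M"
    proof (rule greatest)
      fix m assume "m \<in> M"
      then have "infdist (r *\<^sub>R x) M \<le> norm (r *\<^sub>R x - r *\<^sub>R m)"
        using assms by (intro le) (auto intro: subspace_scale)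
      also have "\<dots> = r * norm (x - m)"
        using \<open>r > 0\<close> by (simp flip: scaleR_diff_right)
      finally show "infdist (r *\<^sub>R x) M / r \<le> norm (x - m)"
        using \<open>r > 0\<close> by (simp add: field_simps)
    qed
    then show "infdist (r *\<^sub>R x) M \<le> r * infdist x M"
      using \<open>r > 0\<close> by (simp add: field_simps)
  qed
qed

text \<open>The distance to \<open>M\<close> is the right dominating functional: it vanishes on
  \<open>M\<close>, is at most the norm because \<open>0 \<in> M\<close>, and is nonzero at
  \<open>x\<close> because \<open>M\<close> is closed.\<close>

lemma closed_subspace_separation:
  fixes M :: "'a::real_normed_vector set"
  assumes M: "subspace M" "closed M" and x: "x \<notin> M"
  shows "\<exists>g. bounded_linear g \<and> (\<forall>y\<in>M. g y = (0::real)) \<and> g x \<noteq> 0"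
proof -
  have "0 \<in> M"
    using M(1) by (rule subspace_0)
  obtain g where lin: "linear g" and le: "g \<le> (\<lambda>x. infdist x M)" and gx: "g x = infdist x M"
    using sublinear_dominates_linear[OF sublinear_infdist[OF M(1)]] by blast
  have neg: "- g y \<le> infdist (- y) M" for y
    using le_funD[OF le, of "- y"] lin by (simp add: linear_neg)
  have "\<bar>g y\<bar> \<le> norm y * 1" for y
    using neg[of y] le_funD[OF le, of y] infdist_le[OF \<open>0 \<in> M\<close>, of y] infdist_le[OF \<open>0 \<in> M\<close>, of "- y"]
    by simp
  then have "bounded_linear g"
    using lin by (auto simp: bounded_linear_def bounded_linear_axioms_def intro!: exI[of _ 1])
  moreover have "g y = 0" if "y \<in> M" for y
    using neg[of y] le_funD[OF le, of y] that subspace_neg[OF M(1) that] by simp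
  moreover have "g x \<noteq> 0"
    using gx x in_closed_iff_infdist_zero[OF M(2)] \<open>0 \<in> M\<close> by auto
  ultimately show ?thesis
    by blast
qed

section \<open>Complex subspaces and finite dimensional quotients\<close>

interpretation complex_vector: vector_space "cscale :: complex \<Rightarrow> 'a::cbanach \<Rightarrow> 'a"
  by unfold_locales (simp_all add: cscale_add_right cscale_add_left cscale_cscale cscale_one)

lemma csubspace_eq: "csubspace = complex_vector.subspace"
  by (auto simp: fun_eq_iff csubspace_def complex_vector.subspace_def)

lemma cspan_eq: "cspan = complex_vector.span"
  unfolding fun_eq_iff cspan_def complex_vector.span_def hull_def csubspace_eq by auto

lemma csubspace_cspan: "csubspace (cspan S)"
  by (simp add: csubspace_eq cspan_eq complex_vector.subspace_span)

lemma cspan_subset: "csubspace M \<Longrightarrow> cspan S \<subseteq> M \<longleftrightarrow> S \<subseteq> M"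
  by (metis complex_vector.span_minimal complex_vector.span_superset csubspace_eq cspan_eq order_trans)

lemma cspan_csubspace: "csubspace L \<Longrightarrow> cspan L = L"
  by (simp add: csubspace_eq cspan_eq complex_vector.span_subspace)

lemma cspan_Un_csubspace:
  assumes "csubspace L"
  shows "cspan (B \<union> L) = {b + l |b l. b \<in> cspan B \<and> l \<in> L}"
  using cspan_csubspace[OF assms] by (simp only: cspan_eq complex_vector.span_Un)

lemma subspace_if_csubspace: "csubspace M \<Longrightarrow> subspace M"
  by (auto simp: csubspace_def subspace_def) (metis cscale_of_real)

lemma bounded_linear_cscale_right: "bounded_linear (\<lambda>x. c *\<^sub>C x)"
proof
  show "c *\<^sub>C (r *\<^sub>R x) = r *\<^sub>R (c *\<^sub>C x)" for r and x :: 'a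
    by (simp flip: cscale_of_real add: cscale_cscale mult.commute)
  show "\<exists>K. \<forall>x::'a. norm (c *\<^sub>C x) \<le> norm x * K"
    by (intro exI[of _ "cmod c"]) (simp add: norm_cscale mult.commute)
qed (simp add: cscale_add_right)

lemma bounded_linear_cscale_left: "bounded_linear (\<lambda>c. c *\<^sub>C x)"
proof
  show "(r *\<^sub>R c) *\<^sub>C x = r *\<^sub>R (c *\<^sub>C x)" for r and c :: complex
    by (simp flip: cscale_of_real add: cscale_cscale scaleR_conv_of_real)
  show "\<exists>K. \<forall>c. norm (c *\<^sub>C x) \<le> norm c * K"
    by (intro exI[of _ "norm x"]) (simp add: norm_cscale)
qed (simp add: cscale_add_left)

lemma csubspace_closure:
  assumes "csubspace M"
  shows "csubspace (closure M)"
  unfolding csubspace_def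
proof (intro conjI ballI allI)
  show "0 \<in> closure M"
    using assms closure_subset by (auto simp: csubspace_def)
next
  fix x y assume "x \<in> closure M" "y \<in> closure M"
  then obtain u v where "\<And>n::nat. u n \<in> M" "u \<longlonglongrightarrow> x" "\<And>n. v n \<in> M" "v \<longlonglongrightarrow> y"
    by (auto simp: closure_sequential)
  then have "\<And>n. u n + v n \<in> M" "(\<lambda>n. u n + v n) \<longlonglongrightarrow> x + y"
    using assms by (auto simp: csubspace_def intro: tendsto_add)
  then show "x + y \<in> closure M"
    unfolding closure_sequential by (intro exI[of _ "\<lambda>n. u n + v n"] conjI allI)
next
  fix c x assume "x \<in> closure M"
  then have "c *\<^sub>C x \<in> (\<lambda>x. c *\<^sub>C x) ` closure M"
    by (rule imageI)
  also have "\<dots> \<subseteq> closure ((\<lambda>x. c *\<^sub>C x) ` M)"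
    by (rule closure_bounded_linear_image_subset[OF bounded_linear_cscale_right])
  also have "\<dots> \<subseteq> closure M"
    using assms by (intro closure_mono) (auto simp: csubspace_def)
  finally show "c *\<^sub>C x \<in> closure M" .
qed

section \<open>Complex functionals and finite extensions of closed subspaces\<close>

definition cfunctional :: "('a::cbanach \<Rightarrow> complex) \<Rightarrow> bool" where
  "cfunctional f \<longleftrightarrow> bounded_linear f \<and> (\<forall>c x. f (c *\<^sub>C x) = c * f x)"

lemma closed_csubspace_separation:
  fixes M :: "'a::cbanach set"
  assumes M: "closed_csubspace M" and x: "x \<notin> M"
  shows "\<exists>f. cfunctional f \<and> (\<forall>y\<in>M. f y = 0) \<and> f x = 1"
proof -
  obtain g :: "'a \<Rightarrow> real" where g: "bounded_linear g" "\<forall>y\<in>M. g y = 0" "g x \<noteq> 0"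
    using closed_subspace_separation[of M x] M x subspace_if_csubspace
    by (auto simp: closed_csubspace_def)
  \<comment> \<open>The usual complexification: \<open>f\<close> has real part \<open>g\<close>, and
    it vanishes on \<open>M\<close> because \<open>M\<close> is stable under multiplication by
    \<open>\<i>\<close>.\<close>
  define f where "f y = complex_of_real (g y) - \<i> * complex_of_real (g (\<i> *\<^sub>C y))" for y
  have "bounded_linear (\<lambda>y. g (\<i> *\<^sub>C y))"
    by (rule bounded_linear_compose[OF g(1) bounded_linear_cscale_right])
  then have bl: "bounded_linear f"
    unfolding f_def using g(1)
    by (intro bounded_linear_sub bounded_linear_const_mult
        bounded_linear_compose[OF bounded_linear_of_real])
  interpret g: bounded_linear g by fact
  interpret f: bounded_linear f by fact
  have i: "f (\<i> *\<^sub>C y) = \<i> * f y" for y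
  proof -
    have "g (- y) = - g y"
      by (rule linear_neg[OF g.linear])
    then show ?thesis
      using cscale_of_real[of "- 1" y] by (simp add: f_def cscale_cscale algebra_simps)
  qed
  have r: "f (complex_of_real r *\<^sub>C y) = complex_of_real r * f y" for r y
    by (simp add: cscale_of_real f.scaleR scaleR_conv_of_real)
  have f: "f (c *\<^sub>C y) = c * f y" for c y
  proof -
    have "c *\<^sub>C y = complex_of_real (Re c) *\<^sub>C y + complex_of_real (Im c) *\<^sub>C (\<i> *\<^sub>C y)"
      by (metis complex_eq cscale_add_left cscale_cscale mult.commute)
    then have "f (c *\<^sub>C y) = (complex_of_real (Re c) + \<i> * complex_of_real (Im c)) * f y"
      by (simp only: f.add r i) (simp add: algebra_simps)
    then show ?thesis
      by (simp flip: complex_eq)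
  qed
  have "f y = 0" if "y \<in> M" for y
    using g(2) M that by (simp add: f_def closed_csubspace_def csubspace_def)
  moreover have fx: "f x \<noteq> 0"
    using g(3) by (auto simp: f_def complex_eq_iff)
  moreover have "bounded_linear (\<lambda>y. inverse (f x) * f y)"
    by (intro bounded_linear_const_mult bl)
  ultimately show ?thesis
    unfolding cfunctional_def
    by (intro exI[of _ "\<lambda>y. inverse (f x) * f y"]) (simp add: f)
qed

text \<open>If \<open>f\<close> vanishes on \<open>M\<close> and \<open>f y = 1\<close>, the
  enlarged space is the preimage of \<open>M\<close> under the continuous map sending
  \<open>z\<close> to \<open>z - f z *\<^sub>C y\<close>.\<close>

lemma closed_csubspace_insert:
  assumes M: "closed_csubspace M"
  shows "closed_csubspace (cspan (insert y M))"
proof (cases "y \<in> M")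
  case True
  then have "cspan (insert y M) = M"
    using M by (simp add: insert_absorb closed_csubspace_def cspan_csubspace)
  then show ?thesis
    using M by simp
next
  case False
  then obtain f where f: "cfunctional f" "\<forall>z\<in>M. f z = 0" "f y = 1"
    using closed_csubspace_separation[OF M] by blast
  interpret f: bounded_linear f
    using f(1) by (simp add: cfunctional_def)
  define h where "h z = z - f z *\<^sub>C y" for z
  have M_span: "complex_vector.span M = M"
    using M by (simp add: closed_csubspace_def csubspace_eq)
  have "cspan (insert y M) = h -` M"
  proof (intro set_eqI iffI)
    fix z assume "z \<in> cspan (insert y M)"
    then obtain c where c: "z - c *\<^sub>C y \<in> M"
      by (auto simp: cspan_eq complex_vector.span_insert M_span)
    then have "f (z - c *\<^sub>C y) = 0"
      using f(2) by blast
    then have "f z = c"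
      using f(1,3) by (simp add: f.diff cfunctional_def)
    then show "z \<in> h -` M"
      using c by (simp add: h_def)
  qed (auto simp: cspan_eq complex_vector.span_insert M_span h_def)
  moreover have "continuous_on UNIV h"
    unfolding h_def
    by (intro linear_continuous_on bounded_linear_sub bounded_linear_ident
        bounded_linear_compose[OF bounded_linear_cscale_left f.bounded_linear_axioms])
  ultimately show ?thesis
    using M csubspace_cspan[of "insert y M"]
    by (auto simp: closed_csubspace_def intro: closed_vimage)
qed

lemma closed_csubspace_finite_Un:
  assumes "finite F" and L: "closed_csubspace L"
  shows "closed_csubspace (cspan (F \<union> L))"
  using \<open>finite F\<close>
proof induction
  case empty
  then show ?case
    using L by (simp add: closed_csubspace_def cspan_csubspace)
next
  case (insert y F)
  have "cspan (insert y (cspan (F \<union> L))) = cspan (insert y F \<union> L)"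
    unfolding cspan_eq by (simp add: complex_vector.span_insert complex_vector.span_span)
  then show ?case
    using closed_csubspace_insert[OF insert.IH, of y] by simp
qed

section \<open>Finite dimensional quotients and independent sequences\<close>

lemma findim_quot_iff_cspan:
  assumes "csubspace L"
  shows "findim_quot M L \<longleftrightarrow> (\<exists>B. finite B \<and> B \<subseteq> M \<and> M \<subseteq> cspan (B \<union> L))"
  using assms by (simp add: findim_quot_def cspan_Un_csubspace)

text \<open>The components \<open>b k\<close> of the \<open>x k\<close> in \<open>cspan B\<close>
  inherit independence, since a relation among them would be one among the \<open>x k\<close> modulo
  \<open>L\<close>. But \<open>cspan B\<close> holds at most \<open>card B\<close> independent
  vectors.\<close>

lemma independent_sequence_not_findim:
  fixes x :: "nat \<Rightarrow> 'a::cbanach"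
  assumes L: "csubspace L" and x: "\<And>k. x k \<notin> cspan (x ` {..<k} \<union> L)" and "finite B"
  shows "\<not> range x \<subseteq> cspan (B \<union> L)"
proof
  assume sub: "range x \<subseteq> cspan (B \<union> L)"
  have "\<exists>b. b \<in> cspan B \<and> x k - b \<in> L" for k
  proof -
    have "x k \<in> cspan (B \<union> L)"
      using sub by auto
    then show ?thesis
      using L by (auto simp: cspan_Un_csubspace)
  qed
  then obtain b where b: "\<And>k. b k \<in> cspan B" "\<And>k. x k - b k \<in> L"
    by metis
  have "b j \<in> cspan (x ` {..<k} \<union> L)" if "j < k" for j k
  proof -
    have "x j \<in> cspan (x ` {..<k} \<union> L)" "x j - b j \<in> cspan (x ` {..<k} \<union> L)"
      unfolding cspan_eq using that b(2)[of j] by (simp_all add: complex_vector.span_base)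
    then have "x j - (x j - b j) \<in> cspan (x ` {..<k} \<union> L)"
      unfolding cspan_eq by (rule complex_vector.span_diff)
    then show ?thesis
      by simp
  qed
  then have sub': "cspan (b ` {..<k}) \<subseteq> cspan (x ` {..<k} \<union> L)" for k
    by (auto simp: cspan_subset csubspace_cspan)
  have nb: "b k \<notin> cspan (b ` {..<k})" for k
  proof
    assume "b k \<in> cspan (b ` {..<k})"
    then have "b k + (x k - b k) \<in> cspan (x ` {..<k} \<union> L)"
      using sub' b(2) unfolding cspan_eq
      by (intro complex_vector.span_add) (auto intro: complex_vector.span_base)
    then show False
      using x by simp
  qed
  have "complex_vector.independent (b ` {..<k}) \<and> card (b ` {..<k}) = k" for k
  proof (induction k)
    case 0
    then show ?case
      by (simp add: complex_vector.independent_empty)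
  next
    case (Suc k)
    have "b k \<notin> b ` {..<k}"
      using nb[of k] complex_vector.span_base[of "b k" "b ` {..<k}"] by (metis cspan_eq)
    then show ?case
      using Suc nb[of k]
      by (simp add: lessThan_Suc cspan_eq complex_vector.independent_insertI)
  qed
  moreover have "b ` {..<k} \<subseteq> complex_vector.span B" for k
    using b(1) by (auto simp: cspan_eq)
  ultimately have "k \<le> card B" for k
    using complex_vector.independent_span_bound[OF \<open>finite B\<close>] by metis
  then show False
    using not_less_eq_eq by blast
qed

text \<open>Recursive choice in which a value depends on its predecessors only through the finite
  set they form.\<close>

lemma sequence_avoiding_previous:
  assumes "\<And>(k::nat) F. finite F \<Longrightarrow> \<exists>y. R k F y"
  shows "\<exists>x. \<forall>k. R k (x ` {..<k}) (x k)"
  by (rule dependent_wellorder_choice) (use assms in \<open>auto cong: image_cong_simp\<close>)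

lemma independent_sequence_exists:
  assumes L: "csubspace L" and "\<not> findim_quot M L"
  shows "\<exists>x::nat \<Rightarrow> _. \<forall>k. x k \<in> M \<and> x k \<notin> cspan (x ` {..<k} \<union> L)"
proof -
  \<comment> \<open>The definition of \<open>findim_quot\<close> only speaks of finite
    \<open>B \<subseteq> M\<close>, so the choice of \<open>x k\<close> is made conditional on the
    earlier values lying in \<open>M\<close>; induction removes the condition.\<close>
  have "\<exists>x::nat \<Rightarrow> 'a. \<forall>k. x ` {..<k} \<subseteq> M \<longrightarrow> x k \<in> M \<and> x k \<notin> cspan (x ` {..<k} \<union> L)"
    using assms(2) unfolding findim_quot_iff_cspan[OF L]
    by (intro sequence_avoiding_previous) blast
  then obtain x :: "nat \<Rightarrow> 'a"
    where x: "\<And>k. x ` {..<k} \<subseteq> M \<Longrightarrow> x k \<in> M \<and> x k \<notin> cspan (x ` {..<k} \<union> L)"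
    by blast
  have "x k \<in> M" for k
  proof (induction k rule: less_induct)
    case (less k)
    then show ?case
      using x[of k] by auto
  qed
  then show ?thesis
    using x by blast
qed

text \<open>Frees \<open>B\<close> from the demand \<open>B \<subseteq> M\<close> of the definition:
  otherwise an independent sequence in \<open>M\<close> would lie in
  \<open>cspan (B \<union> L)\<close>.\<close>

lemma findim_quotI:
  assumes L: "csubspace L" and "finite B" and "M \<subseteq> cspan (B \<union> L)"
  shows "findim_quot M L"
  using independent_sequence_exists[OF L, of M] independent_sequence_not_findim[OF L _ \<open>finite B\<close>]
    assms(3) by blast

lemma not_findim_quotI:
  assumes L: "csubspace L" and "\<And>k. x k \<in> M" and "\<And>k::nat. x k \<notin> cspan (x ` {..<k} \<union> L)"
  shows "\<not> findim_quot M L"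
  using independent_sequence_not_findim[OF L assms(3)] assms(2)
  unfolding findim_quot_iff_cspan[OF L] by blast

lemma decreasing_independent:
  fixes N :: "nat \<Rightarrow> 'a::cbanach set"
  assumes N: "\<And>k. csubspace (N k)" and dec: "decseq N"
    and y: "\<And>k. y k \<in> N k" "\<And>k. y k \<notin> N (Suc k)"
  shows "y k \<notin> cspan (y ` {..<k} \<union> N (Suc k))"
proof
  assume "y k \<in> cspan (y ` {..<k} \<union> N (Suc k))"
  then obtain s v where s: "s \<in> cspan (y ` {..<k})" and v: "v \<in> N (Suc k)" and sv: "y k = s + v"
    using N by (auto simp: cspan_Un_csubspace)
  \<comment> \<open>In the induction step, the part of \<open>z\<close> before \<open>y k\<close>
    lies in \<open>N k\<close> and vanishes by hypothesis, and a nonzero multiple of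
    \<open>y k\<close> is not in \<open>N (Suc k)\<close>.\<close>
  have triv: "z = 0" if "z \<in> cspan (y ` {..<k})" "z \<in> N k" for z k
    using that
  proof (induction k arbitrary: z)
    case 0
    then show ?case
      by (simp add: cspan_eq)
  next
    case (Suc k)
    then obtain c where c: "z - c *\<^sub>C y k \<in> cspan (y ` {..<k})"
      by (auto simp: lessThan_Suc cspan_eq complex_vector.span_insert)
    have "N (Suc k) \<subseteq> N k"
      using dec by (simp add: decseq_Suc_iff)
    then have "z - c *\<^sub>C y k \<in> N k"
      using Suc.prems(2) N[of k] y(1)[of k]
      by (auto simp: csubspace_eq intro: complex_vector.subspace_diff complex_vector.subspace_scale)
    then have z: "z = c *\<^sub>C y k"
      using Suc.IH[OF c] by simp
    moreover have "c = 0"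
    proof (rule ccontr)
      assume "c \<noteq> 0"
      then have "y k = inverse c *\<^sub>C z"
        using z by (simp add: cscale_cscale cscale_one)
      then show False
        using Suc.prems(2) N[of "Suc k"] y(2)[of k] by (auto simp: csubspace_def)
    qed
    ultimately show ?case
      by simp
  qed
  have "N (Suc k) \<subseteq> N k"
    using dec by (simp add: decseq_Suc_iff)
  then have "y k - v \<in> N k"
    using N[of k] y(1)[of k] v by (auto simp: csubspace_eq intro: complex_vector.subspace_diff)
  then have "s = 0"
    using triv[OF s] sv by simp
  then show False
    using sv v y(2)[of k] by simp
qed

lemma findim_quot_mono:
  assumes "csubspace L" and "findim_quot M L" and "M' \<subseteq> M"
  shows "findim_quot M' L"
proof -
  obtain B where "finite B" "M \<subseteq> cspan (B \<union> L)"
    using assms(2) unfolding findim_quot_iff_cspan[OF assms(1)] by blast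
  then show ?thesis
    using assms by (intro findim_quotI[of L B]) auto
qed

lemma bop_cspan_image: "bop T \<Longrightarrow> T ` cspan S \<subseteq> cspan (T ` S)"
proof -
  assume T: "bop T"
  interpret bounded_linear T
    using T by (simp add: bop_def)
  have "csubspace (T -` cspan (T ` S))"
    using T csubspace_cspan[of "T ` S"] by (auto simp: csubspace_def bop_def add)
  moreover have "S \<subseteq> T -` cspan (T ` S)"
    by (auto simp: cspan_eq intro!: complex_vector.span_base)
  ultimately show ?thesis
    using cspan_subset by blast
qed

section \<open>Operators given by absolutely convergent series\<close>

lemma closed_csubspace_sums:
  assumes M: "closed_csubspace M" and "\<And>k. a k \<in> M" and "a sums s"
  shows "s \<in> M"
proof (rule closed_sequentially)
  show "closed M"
    using M by (simp add: closed_csubspace_def)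
  show "(\<lambda>n. \<Sum>k<n. a k) \<longlonglongrightarrow> s"
    using \<open>a sums s\<close> by (simp add: sums_def)
  show "(\<Sum>k<n. a k) \<in> M" for n
    using M assms(2) by (auto simp: closed_csubspace_def csubspace_eq intro: complex_vector.subspace_sum)
qed

lemma bop_rank_one: "cfunctional f \<Longrightarrow> bop (\<lambda>y. f y *\<^sub>C x)"
  unfolding cfunctional_def bop_def
  by (auto simp: cscale_cscale intro: bounded_linear_compose[OF bounded_linear_cscale_left])

text \<open>Only \<open>c k \<noteq> 0\<close> is recorded about the weights: nonzero factors change
  neither the zeros of \<open>f k\<close> nor the subspaces that contain \<open>x k\<close>.\<close>

lemma nuclear_operator_exists:
  fixes f :: "nat \<Rightarrow> 'a::cbanach \<Rightarrow> complex" and x :: "nat \<Rightarrow> 'a"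
  assumes f: "\<And>k. cfunctional (f k)"
  shows "\<exists>c T. (\<forall>k. c k \<noteq> 0) \<and> bop T \<and> (\<forall>y. (\<lambda>k. (c k * f k y) *\<^sub>C x k) sums T y)"
proof -
  have bl: "bounded_linear (f k)" and hom: "f k (c *\<^sub>C y) = c * f k y" for k c y
    using f by (auto simp: cfunctional_def)
  \<comment> \<open>The denominator exceeds the norm of the \<open>k\<close>th rank one operator,
    and its summand 1 keeps it positive. The factor \<open>(1 / 2) ^ k\<close> makes the series
    converge absolutely.\<close>
  define r where "r k = (1 / 2) ^ k / (1 + onorm (f k) * norm (x k))" for k
  define a where "a y k = (complex_of_real (r k) * f k y) *\<^sub>C x k" for y k
  define T where "T y = (\<Sum>k. a y k)" for y
  have pos: "1 + onorm (f k) * norm (x k) > 0" for k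
    using onorm_pos_le[OF bl, of k] by (simp add: add_pos_nonneg)
  have bound: "norm (a y k) \<le> (1 / 2) ^ k * norm y" for y k
  proof -
    have "norm (f k y) * norm (x k) \<le> (onorm (f k) * norm y) * norm (x k)"
      by (intro mult_right_mono onorm bl) auto
    also have "\<dots> \<le> (1 + onorm (f k) * norm (x k)) * norm y"
      by (simp add: algebra_simps)
    finally have "r k * (norm (f k y) * norm (x k)) \<le> r k * ((1 + onorm (f k) * norm (x k)) * norm y)"
      using pos[of k] by (intro mult_left_mono) (auto simp: r_def)
    moreover have "r k * ((1 + onorm (f k) * norm (x k)) * norm y) = (1 / 2) ^ k * norm y"
      using pos[of k] by (simp add: r_def)
    moreover have "r k \<ge> 0"
      using pos[of k] by (simp add: r_def)
    ultimately show ?thesis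
      by (simp add: a_def norm_cscale norm_mult)
  qed
  have geo: "(\<lambda>k. (1 / 2) ^ k * norm y) sums (2 * norm y)" for y :: 'a
    using sums_mult2[OF geometric_sums[of "1 / 2 :: real"], of "norm y"] by simp
  have summable_a: "summable (\<lambda>k. norm (a y k))" for y
    by (rule summable_comparison_test'[OF sums_summable[OF geo]]) (use bound in auto)
  then have sums: "a y sums T y" for y
    unfolding T_def by (rule summable_sums[OF summable_norm_cancel])
  have "bounded_linear T"
  proof
    show "T (y + z) = T y + T z" for y z
    proof (rule sums_unique2[OF sums])
      have "a (y + z) = (\<lambda>k. a y k + a z k)"
        by (simp add: fun_eq_iff a_def linear_add[OF bounded_linear.linear[OF bl]] distrib_left cscale_add_left)
      then show "a (y + z) sums (T y + T z)"
        using sums_add[OF sums[of y] sums[of z]] by simp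
    qed
    show "T (s *\<^sub>R y) = s *\<^sub>R T y" for s y
    proof (rule sums_unique2[OF sums])
      have "a (s *\<^sub>R y) = (\<lambda>k. s *\<^sub>R a y k)"
        by (simp add: a_def hom cscale_cscale mult_ac fun_eq_iff flip: cscale_of_real[of s])
      then show "a (s *\<^sub>R y) sums (s *\<^sub>R T y)"
        using sums_scaleR_right[OF sums[of y], of s] by simp
    qed
    have "norm (T y) \<le> norm y * 2" for y
    proof -
      have "norm (T y) \<le> (\<Sum>k. norm (a y k))"
        unfolding T_def by (rule summable_norm[OF summable_a])
      also have "\<dots> \<le> 2 * norm y"
        using suminf_le[OF bound summable_a sums_summable[OF geo]] sums_unique[OF geo, of y] by simp
      finally show ?thesis
        by simp
    qed
    then show "\<exists>K. \<forall>y. norm (T y) \<le> norm y * K"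
      by blast
  qed
  moreover have "T (c *\<^sub>C y) = c *\<^sub>C T y" for c y
  proof (rule sums_unique2[OF sums])
    have "a (c *\<^sub>C y) = (\<lambda>k. c *\<^sub>C a y k)"
      by (simp add: a_def hom fun_eq_iff cscale_cscale mult_ac)
    then show "a (c *\<^sub>C y) sums (c *\<^sub>C T y)"
      using bounded_linear.sums[OF bounded_linear_cscale_right sums[of y], of c] by simp
  qed
  moreover have "r k \<noteq> 0" for k
    using pos[of k] by (simp add: r_def)
  ultimately show ?thesis
    using sums unfolding bop_def a_def by (intro exI[of _ "\<lambda>k. complex_of_real (r k)"] exI[of _ T]) auto
qed

section \<open>Nests and bimodules\<close>

lemma join_upper: "E \<in> F \<Longrightarrow> E \<subseteq> join F"
  unfolding join_def cspan_eq
  by (rule order_trans[OF order_trans[OF _ complex_vector.span_superset] closure_subset]) blast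

lemma join_subset_iff:
  assumes "closed_csubspace G"
  shows "join F \<subseteq> G \<longleftrightarrow> (\<forall>E\<in>F. E \<subseteq> G)"
proof
  assume "\<forall>E\<in>F. E \<subseteq> G"
  then have "cspan (\<Union>F) \<subseteq> G"
    using assms by (auto simp: closed_csubspace_def cspan_subset)
  then show "join F \<subseteq> G"
    unfolding join_def using assms by (intro closure_minimal) (auto simp: closed_csubspace_def)
next
  assume "join F \<subseteq> G"
  then show "\<forall>E\<in>F. E \<subseteq> G"
    using join_upper order_trans by metis
qed

locale subspace_nest =
  fixes \<E> :: "'a::cbanach set set"
  assumes nest: "nest \<E>"
begin

lemma closed_csubspace_nest: "E \<in> \<E> \<Longrightarrow> closed_csubspace E"
  using nest by (simp add: nest_def)

lemma csubspace_nest: "E \<in> \<E> \<Longrightarrow> csubspace E"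
  using closed_csubspace_nest by (simp add: closed_csubspace_def)

lemma zero_in_nest: "E \<in> \<E> \<Longrightarrow> 0 \<in> E"
  using csubspace_nest by (simp add: csubspace_def)

lemma nest_cases: "E \<in> \<E> \<Longrightarrow> F \<in> \<E> \<Longrightarrow> E \<subseteq> F \<or> F \<subset> E"
  using nest unfolding nest_def by blast

lemma nest_bot: "{0} \<in> \<E>"
  using nest by (simp add: nest_def)

lemma nest_Inter: "F \<subseteq> \<E> \<Longrightarrow> \<Inter>F \<in> \<E>" and nest_join: "F \<subseteq> \<E> \<Longrightarrow> join F \<in> \<E>"
  using nest by (auto simp: nest_def)

lemma nest_minus_in: "nest_minus \<E> E \<in> \<E>"
  unfolding nest_minus_def by (auto intro: nest_join)

lemma nest_plus_lower: "F \<in> \<E> \<Longrightarrow> E \<subset> F \<Longrightarrow> nest_plus \<E> E \<subseteq> F"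
  by (auto simp: nest_plus_def)

lemma nest_minus_upper: "F \<in> \<E> \<Longrightarrow> F \<subset> E \<Longrightarrow> F \<subseteq> nest_minus \<E> E"
  unfolding nest_minus_def by (rule join_upper) simp

lemma nest_minus_subset: "E \<in> \<E> \<Longrightarrow> nest_minus \<E> E \<subseteq> E"
  unfolding nest_minus_def by (auto simp: join_subset_iff closed_csubspace_nest)

text \<open>No element of the nest lies strictly between \<open>L\<close> and
  \<open>nest_plus \<E> L\<close>.\<close>

lemma subset_if_psubset_nest_plus: "P \<in> \<E> \<Longrightarrow> L \<in> \<E> \<Longrightarrow> P \<subset> nest_plus \<E> L \<Longrightarrow> P \<subseteq> L"
  using nest_cases[of P L] nest_plus_lower[of P L] by blast

section \<open>The bimodule axioms and maximality\<close>

lemma M_Phi_M_e_bimodule: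
  assumes \<Phi>: "\<And>E. E \<in> \<E> \<Longrightarrow> \<Phi> E \<in> \<E>"
  shows "bimodule \<E> (M_Phi \<E> \<Phi> \<inter> M_e \<E> \<Psi>)"
proof -
  have zero: "(\<lambda>x. 0) \<in> M_Phi \<E> \<Phi> \<inter> M_e \<E> \<Psi>"
  proof -
    have "bop (\<lambda>x::'a. 0::'a)"
      using complex_vector.scale_zero_right by (auto simp: bop_def)
    moreover have "findim_quot ((\<lambda>x. 0) ` N) L" if "L \<in> \<E>" for N :: "'a set" and L
      using zero_in_nest[OF that] csubspace_nest[OF that]
      by (intro findim_quotI[of L "{}"]) (auto simp: cspan_csubspace)
    moreover have "0 \<in> \<Phi> E" if "E \<in> \<E>" for E
      by (intro zero_in_nest \<Phi> that)
    ultimately show ?thesis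
      by (auto simp: M_Phi_def M_e_def)
  qed
  have add: "(\<lambda>x. S x + T x) \<in> M_Phi \<E> \<Phi> \<inter> M_e \<E> \<Psi>"
    if S: "S \<in> M_Phi \<E> \<Phi> \<inter> M_e \<E> \<Psi>" and T: "T \<in> M_Phi \<E> \<Phi> \<inter> M_e \<E> \<Psi>" for S T
  proof -
    have "bop (\<lambda>x. S x + T x)"
      using S T by (auto simp: M_Phi_def bop_def cscale_add_right bounded_linear_add)
    moreover have "S x + T x \<in> \<Phi> E" if "E \<in> \<E>" "x \<in> E" for E x
    proof -
      have "S x \<in> \<Phi> E" "T x \<in> \<Phi> E"
        using S T that unfolding M_Phi_def by blast+
      then show ?thesis
        using csubspace_nest[OF \<Phi>[OF \<open>E \<in> \<E>\<close>]] by (simp add: csubspace_def)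
    qed
    moreover have "findim_quot ((\<lambda>x. S x + T x) ` N) L"
      if NL: "N \<in> \<E>" "L \<in> \<E>" "\<Psi> N \<subset> nest_plus \<E> L" for N L
    proof -
      obtain B C where "finite B" "S ` N \<subseteq> cspan (B \<union> L)" "finite C" "T ` N \<subseteq> cspan (C \<union> L)"
      proof -
        have "findim_quot (S ` N) L" "findim_quot (T ` N) L"
          using S T NL unfolding M_e_def by blast+
        then show thesis
          using that unfolding findim_quot_iff_cspan[OF csubspace_nest[OF \<open>L \<in> \<E>\<close>]] by metis
      qed
      moreover have "cspan (B \<union> L) \<subseteq> cspan (B \<union> C \<union> L)" "cspan (C \<union> L) \<subseteq> cspan (B \<union> C \<union> L)"
        unfolding cspan_eq by (rule complex_vector.span_mono, blast)+
      ultimately have "(\<lambda>x. S x + T x) ` N \<subseteq> cspan (B \<union> C \<union> L)"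
        unfolding cspan_eq by (force intro: complex_vector.span_add)
      then show ?thesis
        using \<open>finite B\<close> \<open>finite C\<close> csubspace_nest[OF \<open>L \<in> \<E>\<close>]
        by (intro findim_quotI[of L "B \<union> C"]) auto
    qed
    ultimately show ?thesis
      by (auto simp: M_Phi_def M_e_def)
  qed
  have left: "A \<circ> T \<in> M_Phi \<E> \<Phi> \<inter> M_e \<E> \<Psi>"
    if T: "T \<in> M_Phi \<E> \<Phi> \<inter> M_e \<E> \<Psi>" and A: "A \<in> nest_alg \<E>" for T A
  proof -
    have "bop (A \<circ> T)"
      using A T by (auto simp: nest_alg_def M_Phi_def bop_def o_def intro: bounded_linear_compose)
    moreover have "A (T x) \<in> \<Phi> E" if "E \<in> \<E>" "x \<in> E" for E x
      using A T that \<Phi> unfolding nest_alg_def M_Phi_def by blast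
    moreover have "findim_quot ((A \<circ> T) ` N) L"
      if NL: "N \<in> \<E>" "L \<in> \<E>" "\<Psi> N \<subset> nest_plus \<E> L" for N L
    proof -
      obtain B where B: "finite B" "T ` N \<subseteq> cspan (B \<union> L)"
      proof -
        have "findim_quot (T ` N) L"
          using T NL unfolding M_e_def by blast
        then show thesis
          using that unfolding findim_quot_iff_cspan[OF csubspace_nest[OF \<open>L \<in> \<E>\<close>]] by metis
      qed
      \<comment> \<open>Left multiplication replaces the finite set \<open>B\<close> by its image
        under \<open>A\<close>; the summand \<open>L\<close> survives because \<open>A\<close> maps
        it into itself.\<close>
      then have "(A \<circ> T) ` N \<subseteq> A ` cspan (B \<union> L)"
        by auto
      also have "\<dots> \<subseteq> cspan (A ` (B \<union> L))"
        using A by (intro bop_cspan_image) (simp add: nest_alg_def)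
      also have "\<dots> \<subseteq> cspan (A ` B \<union> L)"
        using A \<open>L \<in> \<E>\<close> unfolding cspan_eq by (intro complex_vector.span_mono) (auto simp: nest_alg_def)
      finally show ?thesis
        using B(1) csubspace_nest[OF \<open>L \<in> \<E>\<close>] by (intro findim_quotI[of L "A ` B"]) auto
    qed
    ultimately show ?thesis
      by (auto simp: M_Phi_def M_e_def)
  qed
  have right: "T \<circ> A \<in> M_Phi \<E> \<Phi> \<inter> M_e \<E> \<Psi>"
    if T: "T \<in> M_Phi \<E> \<Phi> \<inter> M_e \<E> \<Psi>" and A: "A \<in> nest_alg \<E>" for T A
  proof -
    have "bop (T \<circ> A)"
      using A T by (auto simp: nest_alg_def M_Phi_def bop_def o_def intro: bounded_linear_compose)
    moreover have "T (A x) \<in> \<Phi> E" if "E \<in> \<E>" "x \<in> E" for E x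
      using A T that unfolding nest_alg_def M_Phi_def by blast
    moreover have "findim_quot ((T \<circ> A) ` N) L"
      if NL: "N \<in> \<E>" "L \<in> \<E>" "\<Psi> N \<subset> nest_plus \<E> L" for N L
    proof (rule findim_quot_mono)
      show "findim_quot (T ` N) L"
        using T NL unfolding M_e_def by blast
      show "(T \<circ> A) ` N \<subseteq> T ` N"
        using A NL unfolding nest_alg_def image_comp[symmetric] by (intro image_mono) blast
    qed (use csubspace_nest NL in auto)
    ultimately show ?thesis
      by (auto simp: M_Phi_def M_e_def)
  qed
  have scale: "(\<lambda>x. c *\<^sub>C T x) \<in> M_Phi \<E> \<Phi> \<inter> M_e \<E> \<Psi>"
    if T: "T \<in> M_Phi \<E> \<Phi> \<inter> M_e \<E> \<Psi>" for T c
  proof -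
    \<comment> \<open>Scalar operators belong to the nest algebra, so scaling is a case of
      \<open>left\<close>.\<close>
    have "(\<lambda>x. c *\<^sub>C x) \<in> nest_alg \<E>"
      using csubspace_nest
      by (auto simp: nest_alg_def bop_def bounded_linear_cscale_right cscale_cscale mult.commute csubspace_def)
    moreover have "(\<lambda>x. c *\<^sub>C T x) = (\<lambda>x. c *\<^sub>C x) \<circ> T"
      by auto
    ultimately show ?thesis
      using left[OF T] by metis
  qed
  have bop: "bop T" if "T \<in> M_Phi \<E> \<Phi> \<inter> M_e \<E> \<Psi>" for T
    using that by (auto simp: M_Phi_def)
  show ?thesis
    unfolding bimodule_def by (intro conjI ballI allI zero add scale left right bop)
qed

text \<open>If the image of \<open>N\<close> under \<open>T\<close> is infinite dimensional modulo
  \<open>L\<close>, no \<open>K\<close> in the family defining \<open>supp_e_J\<close> lies inside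
  \<open>L\<close>. Each such \<open>K\<close> then contains \<open>nest_plus \<E> L\<close>, and so
  does the intersection \<open>\<Psi> N\<close>; this explains the condition in
  \<open>M_e\<close>.\<close>

lemma bimodule_subset_M_Phi_M_e:
  assumes J: "\<And>T. T \<in> J \<Longrightarrow> bop T"
    and supp: "\<And>E. E \<in> \<E> \<Longrightarrow> supp_J J E = \<Phi> E" "\<And>E. E \<in> \<E> \<Longrightarrow> supp_e_J \<E> J E = \<Psi> E"
  shows "J \<subseteq> M_Phi \<E> \<Phi> \<inter> M_e \<E> \<Psi>"
proof
  fix T assume T: "T \<in> J"
  have "T x \<in> \<Phi> E" if "E \<in> \<E>" "x \<in> E" for E x
  proof -
    have "T x \<in> complex_vector.span {T x |T x. T \<in> J \<and> x \<in> E}"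
      using T that by (intro complex_vector.span_base) auto
    then show ?thesis
      unfolding supp(1)[OF \<open>E \<in> \<E>\<close>, symmetric] supp_J_def cspan_eq
      by (rule subsetD[OF closure_subset])
  qed
  moreover have "findim_quot (T ` N) L"
    if N: "N \<in> \<E>" and L: "L \<in> \<E>" and plus: "\<Psi> N \<subset> nest_plus \<E> L" for N L
  proof (rule ccontr)
    assume not: "\<not> findim_quot (T ` N) L"
    have "nest_plus \<E> L \<subseteq> K" if K: "K \<in> \<E>" "\<forall>T\<in>J. findim_quot (T ` N) K" for K
    proof -
      have "\<not> K \<subseteq> L"
      proof
        assume "K \<subseteq> L"
        obtain B where B: "finite B" "T ` N \<subseteq> cspan (B \<union> K)"
          using K T findim_quot_iff_cspan[OF csubspace_nest[OF K(1)]] by blast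
        moreover have "cspan (B \<union> K) \<subseteq> cspan (B \<union> L)"
          unfolding cspan_eq using \<open>K \<subseteq> L\<close> by (intro complex_vector.span_mono) auto
        ultimately show False
          using not findim_quotI[OF csubspace_nest[OF L]] by blast
      qed
      then show ?thesis
        using nest_cases[OF K(1) L] nest_plus_lower[OF K(1)] by blast
    qed
    then have "nest_plus \<E> L \<subseteq> supp_e_J \<E> J N"
      unfolding supp_e_J_def by blast
    then show False
      using plus supp(2)[OF N] by blast
  qed
  ultimately show "T \<in> M_Phi \<E> \<Phi> \<inter> M_e \<E> \<Psi>"
    unfolding M_Phi_def M_e_def using J[OF T] by (intro IntI CollectI conjI ballI impI image_subsetI)
qed

section \<open>The support function, and the upper bound for the essential support function\<close>

lemma rank_one_in_M_Phi_M_e: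
  assumes \<Phi>: "\<And>E. E \<in> \<E> \<Longrightarrow> \<Phi> E \<in> \<E>" and f: "cfunctional f"
    and fx: "\<And>E. E \<in> \<E> \<Longrightarrow> (\<forall>y\<in>E. f y = 0) \<or> x \<in> \<Phi> E"
  shows "(\<lambda>y. f y *\<^sub>C x) \<in> M_Phi \<E> \<Phi> \<inter> M_e \<E> \<Psi>"
proof -
  have "f y *\<^sub>C x \<in> \<Phi> E" if "E \<in> \<E>" "y \<in> E" for E y
    using fx[OF that(1)]
  proof
    assume "\<forall>y\<in>E. f y = 0"
    then show ?thesis
      using that zero_in_nest[OF \<Phi>] by simp
  next
    assume "x \<in> \<Phi> E"
    then show ?thesis
      using csubspace_nest[OF \<Phi>[OF that(1)]] by (simp add: csubspace_def)
  qed
  \<comment> \<open>Having rank at most one, the operator meets the essential condition for all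
    \<open>N\<close> and \<open>L\<close>.\<close>
  moreover have "findim_quot ((\<lambda>y. f y *\<^sub>C x) ` N) L" if "L \<in> \<E>" for N L
  proof (rule findim_quotI)
    show "(\<lambda>y. f y *\<^sub>C x) ` N \<subseteq> cspan ({x} \<union> L)"
      unfolding cspan_eq
      by (auto intro!: complex_vector.span_scale intro: complex_vector.span_base)
  qed (use that csubspace_nest in auto)
  ultimately show ?thesis
    using bop_rank_one[OF f] by (auto simp: M_Phi_def M_e_def)
qed

text \<open>If \<open>nest_minus \<E> N \<noteq> N\<close>, a functional vanishing on
  \<open>nest_minus \<E> N\<close> but not on \<open>N\<close> admits every \<open>x\<close> in
  \<open>\<Phi> N\<close>. If \<open>N\<close> is a limit from below, a functional vanishing on some
  \<open>F \<subset> N\<close> but not on \<open>N\<close> only gives access to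
  \<open>\<Phi> F\<close>; admissibility assembles these spaces to \<open>\<Phi> N\<close>.\<close>

lemma supp_J_M_Phi_M_e:
  assumes adm: "admissible \<E> \<Phi>" and bot: "\<Phi> {0} = {0}" and N: "N \<in> \<E>"
  shows "supp_J (M_Phi \<E> \<Phi> \<inter> M_e \<E> \<Psi>) N = \<Phi> N"
proof
  let ?S = "supp_J (M_Phi \<E> \<Phi> \<inter> M_e \<E> \<Psi>) N"
  have \<Phi>: "\<And>E. E \<in> \<E> \<Longrightarrow> \<Phi> E \<in> \<E>" and mono: "\<And>E F. E \<in> \<E> \<Longrightarrow> F \<in> \<E> \<Longrightarrow> E \<subseteq> F \<Longrightarrow> \<Phi> E \<subseteq> \<Phi> F"
    using adm by (auto simp: admissible_def support_function_def)
  have "closed_csubspace (\<Phi> N)"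
    by (intro closed_csubspace_nest \<Phi> N)
  then show "?S \<subseteq> \<Phi> N"
    unfolding supp_J_def closed_csubspace_def using N
    by (intro closure_minimal) (auto simp: cspan_subset M_Phi_def)
  have S: "closed_csubspace ?S"
    unfolding supp_J_def closed_csubspace_def by (simp add: csubspace_closure csubspace_cspan)
  have in_S: "x \<in> ?S" if "cfunctional f" and "y \<in> N" "f y = 1"
    and "\<And>E. E \<in> \<E> \<Longrightarrow> (\<forall>y\<in>E. f y = 0) \<or> x \<in> \<Phi> E" for f x y
  proof -
    have "(\<lambda>y. f y *\<^sub>C x) \<in> M_Phi \<E> \<Phi> \<inter> M_e \<E> \<Psi>"
      using that \<Phi> by (intro rank_one_in_M_Phi_M_e) auto
    moreover have "f y *\<^sub>C x = x"
      using that by (simp add: cscale_one)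
    ultimately have "x \<in> {T y |T y. T \<in> M_Phi \<E> \<Phi> \<inter> M_e \<E> \<Psi> \<and> y \<in> N}"
      using \<open>y \<in> N\<close> by (intro CollectI exI[of _ "\<lambda>y. f y *\<^sub>C x"] exI[of _ y]) simp
    then show ?thesis
      unfolding supp_J_def cspan_eq
      by (intro subsetD[OF closure_subset] complex_vector.span_base)
  qed
  show "\<Phi> N \<subseteq> ?S"
  proof (cases "N = nest_minus \<E> N")
    case False
    then obtain y where y: "y \<in> N" "y \<notin> nest_minus \<E> N"
      using nest_minus_subset[OF N] by blast
    then obtain f where f: "cfunctional f" "\<forall>z\<in>nest_minus \<E> N. f z = 0" "f y = 1"
      using closed_csubspace_separation[OF closed_csubspace_nest[OF nest_minus_in]] by blast
    show ?thesis
    proof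
      fix x assume "x \<in> \<Phi> N"
      then have "(\<forall>y\<in>E. f y = 0) \<or> x \<in> \<Phi> E" if "E \<in> \<E>" for E
        using nest_cases[OF N that] mono[OF N that] nest_minus_upper[OF that] f(2) by blast
      then show "x \<in> ?S"
        using f y by (intro in_S)
    qed
  next
    case minus: True
    show ?thesis
    proof (cases "N = {0}")
      case True
      then show ?thesis
        using bot S by (simp add: closed_csubspace_def csubspace_def)
    next
      case False
      have "\<Phi> F \<subseteq> ?S" if F: "F \<in> \<E>" "F \<subset> N" for F
      proof
        fix x assume x: "x \<in> \<Phi> F"
        obtain y where y: "y \<in> N" "y \<notin> F"
          using F by blast
        then obtain f where f: "cfunctional f" "\<forall>z\<in>F. f z = 0" "f y = 1"
          using closed_csubspace_separation[OF closed_csubspace_nest[OF F(1)]] by blast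
        have "(\<forall>y\<in>E. f y = 0) \<or> x \<in> \<Phi> E" if "E \<in> \<E>" for E
          using nest_cases[OF F(1) that] mono[OF F(1) that] x f(2) by blast
        then show "x \<in> ?S"
          using f y by (intro in_S)
      qed
      then have "join (\<Phi> ` {E \<in> \<E>. E \<subset> N}) \<subseteq> ?S"
        using S by (auto simp: join_subset_iff)
      then show ?thesis
        using adm N False minus by (auto simp: admissible_def)
    qed
  qed
qed

text \<open>Membership in \<open>M_e\<close> puts \<open>\<Psi> N\<close> itself into the
  intersected family unless \<open>\<Psi> N = nest_plus \<E> (\<Psi> N)\<close>. In that case
  \<open>\<Psi> N\<close> is the intersection of all larger \<open>L\<close> in the nest, and these
  belong to the family.\<close>

lemma supp_e_J_M_e_subset:
  assumes "J \<subseteq> M_e \<E> \<Psi>" and N: "N \<in> \<E>" and \<Psi>: "\<Psi> N \<in> \<E>"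
  shows "supp_e_J \<E> J N \<subseteq> \<Psi> N"
proof -
  have *: "supp_e_J \<E> J N \<subseteq> L" if "L \<in> \<E>" "\<Psi> N \<subset> nest_plus \<E> L" for L
    unfolding supp_e_J_def using assms(1) N that by (intro Inter_lower) (auto simp: M_e_def)
  show ?thesis
  proof (cases "\<Psi> N = nest_plus \<E> (\<Psi> N)")
    \<comment> \<open>This covers \<open>\<Psi> N = UNIV\<close>, where \<open>nest_plus\<close> is
      an empty intersection and equals \<open>UNIV\<close>.\<close>
    case True
    have "supp_e_J \<E> J N \<subseteq> L" if "L \<in> \<E>" "\<Psi> N \<subset> L" for L
      using that by (intro *) (auto simp: nest_plus_def)
    then have "supp_e_J \<E> J N \<subseteq> nest_plus \<E> (\<Psi> N)"
      by (auto simp: nest_plus_def)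
    then show ?thesis
      using True by simp
  next
    case False
    moreover have "\<Psi> N \<subseteq> nest_plus \<E> (\<Psi> N)"
      unfolding nest_plus_def by blast
    ultimately show ?thesis
      by (intro * \<Psi>) (rule psubsetI)
  qed
qed

end

section \<open>Further quotients and triangular functionals\<close>

lemma findim_quot_mono_right:
  assumes "csubspace L" and "csubspace L'" and "findim_quot M L" and "L \<subseteq> L'"
  shows "findim_quot M L'"
proof -
  obtain B where "finite B" "M \<subseteq> cspan (B \<union> L)"
    using assms(3) unfolding findim_quot_iff_cspan[OF assms(1)] by blast
  moreover have "cspan (B \<union> L) \<subseteq> cspan (B \<union> L')"
    unfolding cspan_eq using assms(4) by (intro complex_vector.span_mono) auto
  ultimately show ?thesis
    using assms(2) by (intro findim_quotI[of L' B]) auto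
qed

lemma csubspace_bop_image:
  assumes "bop T" and "csubspace M"
  shows "csubspace (T ` M)"
proof -
  interpret bounded_linear T
    using assms(1) by (simp add: bop_def)
  have "T x + T y \<in> T ` M" if "x \<in> M" "y \<in> M" for x y
    using assms(2) that add[of x y, symmetric] by (simp add: csubspace_def)
  moreover have "c *\<^sub>C T x \<in> T ` M" if "x \<in> M" for c x
  proof -
    have "c *\<^sub>C T x = T (c *\<^sub>C x)"
      using assms(1) by (simp add: bop_def)
    then show ?thesis
      using assms(2) that by (simp add: csubspace_def)
  qed
  moreover have "0 \<in> T ` M"
    using assms(2) zero by (force simp: csubspace_def)
  ultimately show ?thesis
    by (auto simp: csubspace_def)
qed

text \<open>The span of \<open>V k\<close> and the earlier \<open>y n\<close> is closed, being a
  finite extension of a closed subspace. Separating \<open>y k\<close> from it yields both the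
  vanishing on \<open>V k\<close> and the triangularity.\<close>

lemma separating_functionals_exist:
  fixes V :: "nat \<Rightarrow> 'a::cbanach set"
  assumes V: "\<And>k. closed_csubspace (V k)" and y: "\<And>k. y k \<notin> cspan (y ` {..<k} \<union> V k)"
  shows "\<exists>f. \<forall>k. cfunctional (f k) \<and> (\<forall>z\<in>V k. f k z = 0) \<and> f k (y k) = 1 \<and> (\<forall>n<k. f k (y n) = 0)"
proof (rule choice, rule allI)
  fix k
  have "closed_csubspace (cspan (y ` {..<k} \<union> V k))"
    by (intro closed_csubspace_finite_Un V) simp
  then obtain f where f: "cfunctional f" "\<forall>z\<in>cspan (y ` {..<k} \<union> V k). f z = 0" "f (y k) = 1"
    using closed_csubspace_separation[OF _ y[of k]] by blast
  have "y ` {..<k} \<union> V k \<subseteq> cspan (y ` {..<k} \<union> V k)"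
    unfolding cspan_eq by (rule complex_vector.span_superset)
  then have "\<forall>z\<in>V k. f z = 0" "\<forall>n<k. f (y n) = 0"
    using f(2) by auto
  then show "\<exists>f. cfunctional f \<and> (\<forall>z\<in>V k. f z = 0) \<and> f (y k) = 1 \<and> (\<forall>n<k. f (y n) = 0)"
    using f by blast
qed

section \<open>Operators that are infinite dimensional modulo a subspace\<close>

context subspace_nest
begin

lemma increasing_cofinal:
  assumes "\<And>k::nat. Ns k \<in> \<E>" and "E \<in> \<E>" and "E \<subset> join (range Ns)"
  shows "\<exists>k. E \<subset> Ns k"
proof (rule ccontr)
  assume "\<nexists>k. E \<subset> Ns k"
  then have "Ns k \<subseteq> E" for k
    using nest_cases[OF assms(1)[of k] assms(2)] by blast
  then have "join (range Ns) \<subseteq> E"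
    using closed_csubspace_nest[OF assms(2)] by (auto simp: join_subset_iff)
  then show False
    using assms(3) by blast
qed

lemma decreasing_cofinal:
  assumes "\<And>k::nat. Ns k \<in> \<E>" and "E \<in> \<E>" and "\<Inter>(range Ns) \<subset> E"
  shows "\<exists>k. Ns k \<subset> E"
proof (rule ccontr)
  assume "\<nexists>k. Ns k \<subset> E"
  then have "E \<subseteq> Ns k" for k
    using nest_cases[OF assms(2) assms(1)[of k]] by blast
  then show False
    using assms(3) by blast
qed

lemma nest_Int: "E \<in> \<E> \<Longrightarrow> F \<in> \<E> \<Longrightarrow> E \<inter> F \<in> \<E>"
  using nest_Inter[of "{E, F}"] by simp

text \<open>Vectors taken from successive differences are independent modulo the next term, hence
  modulo the smaller intersection. The shift by \<open>i\<close> starts the sequence inside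
  \<open>E\<close>.\<close>

lemma not_findim_quot_Inter:
  assumes Ns: "\<And>k::nat. Ns k \<in> \<E>" "\<And>k. Ns (Suc k) \<subset> Ns k" and "E \<in> \<E>" and "\<Inter>(range Ns) \<subset> E"
  shows "\<not> findim_quot E (\<Inter>(range Ns))"
proof -
  obtain i where i: "Ns i \<subset> E"
    using decreasing_cofinal[OF Ns(1) assms(3,4)] by blast
  have "\<exists>y. y \<in> Ns (i + k) \<and> y \<notin> Ns (i + Suc k)" for k
    using Ns(2)[of "i + k"] by auto
  then obtain y where y: "\<And>k. y k \<in> Ns (i + k)" "\<And>k. y k \<notin> Ns (i + Suc k)"
    by metis
  have dec: "decseq (\<lambda>k. Ns (i + k))"
    using Ns(2) by (auto simp: decseq_Suc_iff)
  have *: "y k \<notin> cspan (y ` {..<k} \<union> Ns (i + Suc k))" for k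
    using decreasing_independent[of "\<lambda>k. Ns (i + k)" y, OF csubspace_nest[OF Ns(1)] dec y(1) y(2)] .
  show ?thesis
  proof (rule not_findim_quotI)
    show "csubspace (\<Inter>(range Ns))"
      using Ns(1) by (intro csubspace_nest nest_Inter) auto
    show "y k \<in> E" for k
      using y(1)[of k] decseqD[OF dec, of 0 k] i by auto
    have "cspan (y ` {..<k} \<union> \<Inter>(range Ns)) \<subseteq> cspan (y ` {..<k} \<union> Ns (i + Suc k))" for k
      unfolding cspan_eq by (intro complex_vector.span_mono) auto
    then show "y k \<notin> cspan (y ` {..<k} \<union> \<Inter>(range Ns))" for k
      using *[of k] by blast
  qed
qed

lemma increasing_independent:
  fixes Ns :: "nat \<Rightarrow> 'a set"
  assumes "Ns k \<in> \<E>" and "\<And>n. n < k \<Longrightarrow> y n \<in> Ns k" and "y k \<notin> Ns k"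
  shows "y k \<notin> cspan (y ` {..<k} \<union> Ns k)"
proof -
  have "cspan (y ` {..<k} \<union> Ns k) \<subseteq> Ns k"
    using assms csubspace_nest by (subst cspan_subset) auto
  then show ?thesis
    using assms(3) by blast
qed

end

section \<open>Consequences of the p-property and of admissibility\<close>

locale admissible_nest = subspace_nest \<E> for \<E> :: "'a::cbanach set set" +
  fixes \<Phi> \<Psi> :: "'a set \<Rightarrow> 'a set"
  assumes p_property: "p_property \<E>" and pair: "admissible_pair \<E> \<Phi> \<Psi>"
begin

lemma Phi_in: "E \<in> \<E> \<Longrightarrow> \<Phi> E \<in> \<E>"
  and Phi_mono: "E \<in> \<E> \<Longrightarrow> F \<in> \<E> \<Longrightarrow> E \<subseteq> F \<Longrightarrow> \<Phi> E \<subseteq> \<Phi> F"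
  and Psi_in: "E \<in> \<E> \<Longrightarrow> \<Psi> E \<in> \<E>"
  and Psi_mono: "E \<in> \<E> \<Longrightarrow> F \<in> \<E> \<Longrightarrow> E \<subseteq> F \<Longrightarrow> \<Psi> E \<subseteq> \<Psi> F"
  and Psi_le_Phi: "E \<in> \<E> \<Longrightarrow> \<Psi> E \<subseteq> \<Phi> E"
  using pair
  by (simp_all add: admissible_pair_def admissible_def essential_support_function_def support_function_def)

lemma decreasing_sequence_exists:
  assumes "N \<in> \<E>" and "N \<noteq> UNIV" and "N = nest_plus \<E> N"
  shows "\<exists>Ns::nat \<Rightarrow> 'a set. (\<forall>k. Ns k \<in> \<E>) \<and> (\<forall>k. Ns (Suc k) \<subset> Ns k) \<and> \<Inter>(range Ns) = N"
  using p_property assms unfolding p_property_def by simp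

lemma increasing_sequence_exists:
  assumes "N \<in> \<E>" and "N \<noteq> {0}" and "N = nest_minus \<E> N"
  shows "\<exists>Ns::nat \<Rightarrow> 'a set. (\<forall>k. Ns k \<in> \<E>) \<and> (\<forall>k. Ns k \<subset> Ns (Suc k)) \<and> join (range Ns) = N"
  using p_property assms unfolding p_property_def by simp

text \<open>Either \<open>P\<close> has an infinite dimensional gap above
  \<open>nest_minus \<E> P\<close>, which contains \<open>L\<close>, or \<open>P\<close> is a limit
  from below; then the p-property gives a sequence increasing to \<open>P\<close> from beyond
  \<open>L\<close>, and every step contributes a new vector modulo \<open>L\<close>.\<close>

lemma not_findim_quot_if_not_nest_f:
  assumes P: "P \<in> \<E>" "P \<notin> nest_f \<E>" and L: "L \<in> \<E>" "L \<subset> P"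
  shows "\<not> findim_quot P L"
proof (cases "P = nest_minus \<E> P")
  case False
  then have "\<not> findim_quot P (nest_minus \<E> P)"
    using P nest_minus_subset[OF P(1)] by (auto simp: nest_f_def)
  then show ?thesis
    using findim_quot_mono_right[OF csubspace_nest[OF L(1)] csubspace_nest[OF nest_minus_in]]
      nest_minus_upper[OF L] by blast
next
  case True
  have "P \<noteq> {0}"
    using L zero_in_nest[OF L(1)] by blast
  then obtain Ns :: "nat \<Rightarrow> 'a set" where
    Ns: "\<And>k. Ns k \<in> \<E>" "\<And>k. Ns k \<subset> Ns (Suc k)" "join (range Ns) = P"
    using increasing_sequence_exists[OF P(1) _ True] by blast
  then have inc: "incseq Ns"
    by (auto simp: incseq_Suc_iff)
  obtain i where i: "L \<subset> Ns i"
    using increasing_cofinal[of Ns L] Ns L by blast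
  have "\<exists>y. y \<in> Ns (Suc (i + k)) \<and> y \<notin> Ns (i + k)" for k
    using Ns(2)[of "i + k"] by auto
  then obtain y where y: "\<And>k. y k \<in> Ns (Suc (i + k))" "\<And>k. y k \<notin> Ns (i + k)"
    by metis
  show ?thesis
  proof (rule not_findim_quotI)
    show "csubspace L"
      by (intro csubspace_nest L)
    show "y k \<in> P" for k
      using y(1)[of k] Ns(3) join_upper[of "Ns (Suc (i + k))" "range Ns"] by blast
    show "y k \<notin> cspan (y ` {..<k} \<union> L)" for k
    proof -
      have "y n \<in> Ns (i + k)" if "n < k" for n
        using y(1)[of n] incseqD[OF inc, of "Suc (i + n)" "i + k"] that by auto
      then have "y k \<notin> cspan (y ` {..<k} \<union> Ns (i + k))"
        using increasing_independent[of "\<lambda>k. Ns (i + k)" k y] Ns(1) y(2) by blast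
      moreover have "L \<subseteq> Ns (i + k)"
        using i incseqD[OF inc, of i "i + k"] by auto
      then have "cspan (y ` {..<k} \<union> L) \<subseteq> cspan (y ` {..<k} \<union> Ns (i + k))"
        unfolding cspan_eq by (intro complex_vector.span_mono) auto
      ultimately show ?thesis
        by blast
    qed
  qed
qed

section \<open>Source sequences\<close>

lemma subset_Phi:
  assumes "E \<in> \<E>" and "P \<subseteq> \<Psi> E"
  shows "P \<subseteq> \<Phi> E"
  using assms(2) Psi_le_Phi[OF assms(1)] by (rule order_trans)

lemma psubset_Phi:
  assumes "E \<in> \<E>" and "P \<subseteq> \<Psi> E" and "P \<in> nest_f \<E>"
  shows "P \<subset> \<Phi> E"
proof (cases "P = \<Psi> E")
  case True
  have "\<Psi> E \<in> nest_f \<E> \<longrightarrow> \<Psi> E \<subset> \<Phi> E"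
    using pair assms(1) by (simp add: admissible_pair_def)
  then show ?thesis
    using True assms(3) by simp
next
  case False
  then show ?thesis
    using assms(2) Psi_le_Phi[OF assms(1)] by blast
qed

text \<open>The data from which functionals \<open>f k\<close> vanishing on \<open>V k\<close> are built, with \<open>f k (y n)\<close> lower
  triangular: any \<open>x k \<in> W k\<close> may then be used as the range of the rank one operator of \<open>f k\<close>.\<close>

definition source_sequence ::
  "'a set \<Rightarrow> 'a set \<Rightarrow> (nat \<Rightarrow> 'a set) \<Rightarrow> (nat \<Rightarrow> 'a) \<Rightarrow> (nat \<Rightarrow> 'a set) \<Rightarrow> bool" where
  "source_sequence P N V y W \<longleftrightarrow>
     (\<forall>k. V k \<in> \<E> \<and> y k \<in> N \<and> y k \<notin> cspan (y ` {..<k} \<union> V k)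
        \<and> W k \<in> \<E> \<and> (\<forall>E\<in>\<E>. E \<subseteq> V k \<or> W k \<subseteq> \<Phi> E))
     \<and> (\<forall>E\<in>\<E>. \<not> P \<subseteq> \<Psi> E \<longrightarrow> (\<exists>m. \<forall>k\<ge>m. E \<subseteq> V k))
     \<and> (\<forall>G m. closed_csubspace G \<and> \<not> P \<subseteq> G \<longrightarrow> (\<exists>k\<ge>m. \<not> W k \<inter> P \<subseteq> G))
     \<and> (P \<in> nest_f \<E> \<longrightarrow> (\<forall>m. \<exists>k\<ge>m. P \<subset> W k))"

text \<open>The infimum \<open>N0\<close> is not attained, so it is a limit from above and the
  p-property gives a sequence decreasing to it. All its terms \<open>F\<close> satisfy
  \<open>P \<subseteq> \<Psi> F\<close>, so the ranges contain \<open>P\<close> throughout.\<close>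

lemma source_sequence_limit_from_above:
  assumes N0_def: "N0 = \<Inter>{E \<in> \<E>. P \<subseteq> \<Psi> E}" and not: "\<not> P \<subseteq> \<Psi> N0"
    and N: "N \<in> \<E>" "P \<subseteq> \<Psi> N"
  shows "\<exists>V y W. source_sequence P N V y W"
proof -
  have N0: "N0 \<in> \<E>"
    unfolding N0_def by (intro nest_Inter) auto
  have sub: "N0 \<subset> E" if "E \<in> \<E>" "P \<subseteq> \<Psi> E" for E
    using that not unfolding N0_def by blast
  have above: "P \<subseteq> \<Psi> F" if F: "F \<in> \<E>" "N0 \<subset> F" for F
  proof -
    obtain E where E: "E \<in> \<E>" "P \<subseteq> \<Psi> E" "\<not> F \<subseteq> E"
      using F(2) unfolding N0_def by blast
    then have "E \<subseteq> F"
      using nest_cases[OF F(1) E(1)] by blast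
    then show ?thesis
      using E Psi_mono[OF E(1) F(1)] by blast
  qed
  have "N0 = nest_plus \<E> N0"
  proof
    show "nest_plus \<E> N0 \<subseteq> N0"
      using sub by (subst (2) N0_def) (auto simp: nest_plus_def)
  qed (auto simp: nest_plus_def)
  moreover have "N0 \<noteq> UNIV"
    using sub[OF N] by blast
  ultimately obtain Ms :: "nat \<Rightarrow> 'a set" where
    Ms: "\<And>k. Ms k \<in> \<E>" "\<And>k. Ms (Suc k) \<subset> Ms k" "\<Inter>(range Ms) = N0"
    using decreasing_sequence_exists[OF N0] by blast
  \<comment> \<open>Dropping the first \<open>i\<close> terms brings all \<open>y k\<close> into
    \<open>N\<close>.\<close>
  then obtain i where i: "Ms i \<subset> N"
    using decreasing_cofinal[of Ms N] N(1) sub[OF N] by blast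
  define Ns where "Ns k = Ms (i + k)" for k
  have Ns: "\<And>k. Ns k \<in> \<E>" "\<And>k. Ns (Suc k) \<subset> Ns k"
    using Ms by (auto simp: Ns_def)
  then have dec: "decseq Ns"
    by (auto simp: decseq_Suc_iff)
  have N0_Ns: "N0 \<subset> Ns k" for k
    using Ms(3) Ms(2)[of "i + k"] unfolding Ns_def by blast
  have "\<exists>y. y \<in> Ns k \<and> y \<notin> Ns (Suc k)" for k
    using Ns(2)[of k] by auto
  then obtain y where y: "\<And>k. y k \<in> Ns k" "\<And>k. y k \<notin> Ns (Suc k)"
    by metis
  have Phi: "P \<subseteq> \<Phi> (Ns k)" for k
    by (intro subset_Phi above Ns N0_Ns)
  \<comment> \<open>The shift to \<open>Suc k\<close> is needed because \<open>y k\<close> lies in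
    \<open>Ns k\<close> and only leaves the sequence at the next term.\<close>
  have "source_sequence P N (\<lambda>k. Ns (Suc k)) y (\<lambda>k. \<Phi> (Ns (Suc k)))"
    unfolding source_sequence_def
  proof (intro conjI allI ballI impI)
    show "y k \<in> N" for k
      using y(1)[of k] decseqD[OF dec, of 0 k] i by (auto simp: Ns_def)
    show "y k \<notin> cspan (y ` {..<k} \<union> Ns (Suc k))" for k
      by (rule decreasing_independent[OF csubspace_nest[OF Ns(1)] dec y])
    show "E \<subseteq> Ns (Suc k) \<or> \<Phi> (Ns (Suc k)) \<subseteq> \<Phi> E" if "E \<in> \<E>" for E k
      using nest_cases[OF that Ns(1)[of "Suc k"]] Phi_mono[OF Ns(1)[of "Suc k"] that] by blast
    show "\<exists>m. \<forall>k\<ge>m. E \<subseteq> Ns (Suc k)" if "E \<in> \<E>" "\<not> P \<subseteq> \<Psi> E" for E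
    proof -
      have "E \<subseteq> N0"
        using nest_cases[OF that(1) N0] above[OF that(1)] that(2) by blast
      then show ?thesis
        using N0_Ns by blast
    qed
    show "\<exists>k\<ge>m. \<not> \<Phi> (Ns (Suc k)) \<inter> P \<subseteq> G" if "closed_csubspace G \<and> \<not> P \<subseteq> G" for G m
      using that Phi[of "Suc m"] by (intro exI[of _ m]) auto
    show "\<exists>k\<ge>m. P \<subset> \<Phi> (Ns (Suc k))" if "P \<in> nest_f \<E>" for m
      using that by (intro exI[of _ m] conjI psubset_Phi above Ns N0_Ns) auto
  qed (use Ns Phi_in in auto)
  then show ?thesis
    by blast
qed

text \<open>The single ranges \<open>\<Phi> (Ns k)\<close> need not contain \<open>P\<close>. By
  admissibility at \<open>N0\<close> their join contains \<open>\<Phi> N0\<close> and hence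
  \<open>P\<close>, so they cannot all stay inside a closed subspace that does not contain
  \<open>P\<close>.\<close>

lemma source_sequence_limit_from_below:
  assumes N0: "N0 \<in> \<E>" "N0 \<noteq> {0}" "N0 = nest_minus \<E> N0" and P: "P \<in> \<E>" "P \<subseteq> \<Psi> N0"
    and below: "\<And>E. E \<in> \<E> \<Longrightarrow> \<not> P \<subseteq> \<Psi> E \<Longrightarrow> E \<subset> N0" and N: "N0 \<subseteq> N"
  shows "\<exists>V y W. source_sequence P N V y W"
proof -
  obtain Ns :: "nat \<Rightarrow> 'a set" where
    Ns: "\<And>k. Ns k \<in> \<E>" "\<And>k. Ns k \<subset> Ns (Suc k)" "join (range Ns) = N0"
    using increasing_sequence_exists[OF N0] by blast
  then have inc: "incseq Ns"
    by (auto simp: incseq_Suc_iff)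
  have "\<exists>y. y \<in> Ns (Suc k) \<and> y \<notin> Ns k" for k
    using Ns(2)[of k] by auto
  then obtain y where y: "\<And>k. y k \<in> Ns (Suc k)" "\<And>k. y k \<notin> Ns k"
    by metis
  have Phi_join: "\<Phi> N0 \<subseteq> join (range (\<lambda>k. \<Phi> (Ns k)))"
  proof -
    have "\<Phi> E \<subseteq> join (range (\<lambda>k. \<Phi> (Ns k)))" if E: "E \<in> \<E>" "E \<subset> N0" for E
    proof -
      obtain k where "E \<subset> Ns k"
        using increasing_cofinal[of Ns E] Ns E by blast
      then have "\<Phi> E \<subseteq> \<Phi> (Ns k)"
        by (intro Phi_mono E Ns) auto
      also have "\<dots> \<subseteq> join (range (\<lambda>k. \<Phi> (Ns k)))"
        by (intro join_upper) auto
      finally show ?thesis .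
    qed
    moreover have "closed_csubspace (join (range (\<lambda>k. \<Phi> (Ns k))))"
      using Ns Phi_in by (intro closed_csubspace_nest nest_join) auto
    ultimately have "join (\<Phi> ` {E \<in> \<E>. E \<subset> N0}) \<subseteq> join (range (\<lambda>k. \<Phi> (Ns k)))"
      by (auto simp: join_subset_iff)
    moreover have "join (\<Phi> ` {E \<in> \<E>. E \<subset> N0}) = \<Phi> N0"
      using pair N0 by (auto simp: admissible_pair_def admissible_def)
    ultimately show ?thesis
      by simp
  qed
  have Phi_Ns_mono: "\<Phi> (Ns k) \<subseteq> \<Phi> (Ns l)" if "k \<le> l" for k l
    using that incseqD[OF inc] by (intro Phi_mono Ns) auto
  have "source_sequence P N Ns y (\<lambda>k. \<Phi> (Ns k))"
    unfolding source_sequence_def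
  proof (intro conjI allI ballI impI)
    show "y k \<in> N" for k
      using y(1)[of k] join_upper[of "Ns (Suc k)" "range Ns"] Ns(3) N by blast
    have "y n \<in> Ns k" if "n < k" for n k
      using y(1)[of n] incseqD[OF inc, of "Suc n" k] that by auto
    then show "y k \<notin> cspan (y ` {..<k} \<union> Ns k)" for k
      by (intro increasing_independent Ns y)
    show "E \<subseteq> Ns k \<or> \<Phi> (Ns k) \<subseteq> \<Phi> E" if "E \<in> \<E>" for E k
      using nest_cases[OF that Ns(1)[of k]] Phi_mono[OF Ns(1)[of k] that] by blast
    show "\<exists>m. \<forall>k\<ge>m. E \<subseteq> Ns k" if E: "E \<in> \<E>" "\<not> P \<subseteq> \<Psi> E" for E
    proof -
      obtain m where "E \<subset> Ns m"
        using increasing_cofinal[of Ns E] Ns E(1) below[OF E] by blast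
      then show ?thesis
        using incseqD[OF inc, of m] by blast
    qed
    show "\<exists>k\<ge>m. \<not> \<Phi> (Ns k) \<inter> P \<subseteq> G" if G: "closed_csubspace G \<and> \<not> P \<subseteq> G" for G m
    proof (rule ccontr)
      assume *: "\<not> (\<exists>k\<ge>m. \<not> \<Phi> (Ns k) \<inter> P \<subseteq> G)"
      have sub: "\<Phi> (Ns k) \<inter> P \<subseteq> G" for k
        using * Phi_Ns_mono[of k "max k m"] max.cobounded1[of k m] max.cobounded2[of m k] by blast
      \<comment> \<open>By comparability \<open>\<Phi> (Ns k) \<inter> P\<close> is one of the two
        spaces, and it cannot be \<open>P\<close>, which is not inside \<open>G\<close>.\<close>
      have "\<Phi> (Ns k) \<subseteq> G" for k
        using nest_cases[OF Phi_in[OF Ns(1)[of k]] P(1)] sub[of k] G by blast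
      then have "join (range (\<lambda>k. \<Phi> (Ns k))) \<subseteq> G"
        using G by (auto simp: join_subset_iff)
      then show False
        using Phi_join subset_Phi[OF N0(1) P(2)] G by blast
    qed
    show "\<exists>k\<ge>m. P \<subset> \<Phi> (Ns k)" if f: "P \<in> nest_f \<E>" for m
    proof -
      have "P \<subset> join (range (\<lambda>k. \<Phi> (Ns k)))"
        using psubset_Phi[OF N0(1) P(2) f] Phi_join by blast
      then obtain l where "P \<subset> \<Phi> (Ns l)"
        using increasing_cofinal[of "\<lambda>k. \<Phi> (Ns k)" P] P(1) Phi_in Ns(1) by blast
      then show ?thesis
        using Phi_Ns_mono[of l "max l m"] by (intro exI[of _ "max l m"]) auto
    qed
  qed (use Ns Phi_in in auto)
  then show ?thesis
    by blast
qed

text \<open>Infinitely many vectors independent modulo \<open>nest_minus \<E> N0\<close> fit into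
  the gap, so the annihilated subspace and the range can both be constant.\<close>

lemma source_sequence_gap:
  assumes N0: "N0 \<in> \<E>" "\<not> findim_quot N0 (nest_minus \<E> N0)" and P: "P \<subseteq> \<Psi> N0"
    and below: "\<And>E. E \<in> \<E> \<Longrightarrow> \<not> P \<subseteq> \<Psi> E \<Longrightarrow> E \<subset> N0" and N: "N0 \<subseteq> N"
  shows "\<exists>V y W. source_sequence P N V y W"
proof -
  obtain y :: "nat \<Rightarrow> 'a" where
    y: "\<And>k. y k \<in> N0" "\<And>k. y k \<notin> cspan (y ` {..<k} \<union> nest_minus \<E> N0)"
    using independent_sequence_exists[OF csubspace_nest[OF nest_minus_in] N0(2)] by blast
  have "source_sequence P N (\<lambda>k. nest_minus \<E> N0) y (\<lambda>k. \<Phi> N0)"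
    unfolding source_sequence_def
  proof (intro conjI allI ballI impI)
    show "y k \<in> N" for k
      using y(1)[of k] N by blast
    show "E \<subseteq> nest_minus \<E> N0 \<or> \<Phi> N0 \<subseteq> \<Phi> E" if "E \<in> \<E>" for E k
      using nest_cases[OF N0(1) that] Phi_mono[OF N0(1) that] nest_minus_upper[OF that] by blast
    show "\<exists>m::nat. \<forall>k\<ge>m. E \<subseteq> nest_minus \<E> N0" if "E \<in> \<E>" "\<not> P \<subseteq> \<Psi> E" for E
      using below[OF that] nest_minus_upper[OF that(1)] by blast
    show "\<exists>k\<ge>m. \<not> \<Phi> N0 \<inter> P \<subseteq> G" if "closed_csubspace G \<and> \<not> P \<subseteq> G" for G and m :: nat
      using that subset_Phi[OF N0(1) P] order_refl[of m] by blast
    show "\<exists>k\<ge>m. P \<subset> \<Phi> N0" if "P \<in> nest_f \<E>" for m :: nat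
      using psubset_Phi[OF N0(1) P that] by blast
  qed (use y N0 Phi_in nest_minus_in in auto)
  then show ?thesis
    by blast
qed

lemma source_sequence_exists:
  assumes P: "P \<in> \<E>" "P \<noteq> {0}" and N: "N \<in> \<E>" "P \<subseteq> \<Psi> N"
  shows "\<exists>V y W. source_sequence P N V y W"
proof -
  define N0 where "N0 = \<Inter>{E \<in> \<E>. P \<subseteq> \<Psi> E}"
  have N0: "N0 \<in> \<E>"
    unfolding N0_def by (intro nest_Inter) auto
  have N0_N: "N0 \<subseteq> N"
    using N unfolding N0_def by blast
  show ?thesis
  proof (cases "P \<subseteq> \<Psi> N0")
    case False
    then show ?thesis
      using source_sequence_limit_from_above[OF N0_def _ N] by blast
  next
    case True
    have below: "E \<subset> N0" if "E \<in> \<E>" "\<not> P \<subseteq> \<Psi> E" for E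
      using nest_cases[OF N0 that(1)] Psi_mono[OF N0 that(1)] that(2) True by blast
    \<comment> \<open>Excludes the degenerate case \<open>nest_minus \<E> {0} = {0}\<close>, for
      which the p-property offers no sequence.\<close>
    have "N0 \<noteq> {0}"
    proof
      assume "N0 = {0}"
      then have "P \<subseteq> {0}"
        using True Psi_le_Phi[OF nest_bot] pair by (auto simp: admissible_pair_def)
      then show False
        using P zero_in_nest[OF P(1)] by blast
    qed
    show ?thesis
    proof (cases "N0 = nest_minus \<E> N0")
      case minus: True
      show ?thesis
        by (rule source_sequence_limit_from_below[OF N0 \<open>N0 \<noteq> {0}\<close> minus P(1) True below N0_N])
    next
      case False
      \<comment> \<open>A finite dimensional gap would give
        \<open>\<Psi> (nest_minus \<E> N0) = \<Psi> N0\<close>, and a strictly smaller subspace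
        would enter the family whose infimum is \<open>N0\<close>.\<close>
      have "\<not> findim_quot N0 (nest_minus \<E> N0)"
      proof
        assume "findim_quot N0 (nest_minus \<E> N0)"
        then have "\<Psi> N0 = \<Psi> (nest_minus \<E> N0)"
          using pair N0 nest_minus_in[of N0] nest_minus_subset[OF N0]
          unfolding admissible_pair_def essential_support_function_def by blast
        moreover have "nest_minus \<E> N0 \<subset> N0"
          using False nest_minus_subset[OF N0] by blast
        ultimately show False
          using True nest_minus_in[of N0] unfolding N0_def by blast
      qed
      then show ?thesis
        by (rule source_sequence_gap[OF N0 _ True below N0_N])
    qed
  qed
qed


text \<open>A given \<open>W j\<close> may be too small to supply a new vector, so the index
  \<open>j\<close> is chosen together with the vector, as late as necessary. The auxiliary sets
  \<open>Z k\<close> reconcile two demands: they are large enough to leave every finite extension of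
  \<open>L\<close>, and small enough to end up in each relevant \<open>K\<close>.\<close>

lemma target_sequence_exists:
  assumes src: "source_sequence P N V y W" and P: "P \<in> \<E>" and L: "L \<in> \<E>" "L \<subset> P"
    and P_plus: "P \<in> nest_f \<E> \<longrightarrow> P = nest_plus \<E> P"
  shows "\<exists>(x :: nat \<Rightarrow> 'a) j. strict_mono j \<and> (\<forall>k. x k \<in> W (j k) \<and> x k \<notin> cspan (x ` {..<k} \<union> L))
    \<and> (\<forall>K\<in>\<E>. P \<subset> nest_plus \<E> K \<longrightarrow> (\<exists>m. \<forall>k\<ge>m. x k \<in> K))"
proof -
  have W: "W k \<in> \<E>" for k
    using src by (simp add: source_sequence_def)
  obtain Z :: "nat \<Rightarrow> 'a set" where
    avoid: "\<And>k m F. finite F \<Longrightarrow> \<exists>j\<ge>m. \<not> W j \<inter> Z k \<subseteq> cspan (F \<union> L)" and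
    small: "\<And>K. K \<in> \<E> \<Longrightarrow> P \<subset> nest_plus \<E> K \<Longrightarrow> \<exists>m. \<forall>k\<ge>m. Z k \<subseteq> K"
  proof (cases "P \<in> nest_f \<E>")
    case False
    show thesis
    proof (rule that[of "\<lambda>k. P"])
      show "\<exists>j\<ge>m. \<not> W j \<inter> P \<subseteq> cspan (F \<union> L)" if "finite F" for m F
      proof -
        \<comment> \<open>Since \<open>P/L\<close> is infinite dimensional, no finite extension of
          \<open>L\<close> contains \<open>P\<close>; being closed, the extension can serve as
          \<open>G\<close> in \<open>source_sequence\<close>.\<close>
        have "\<not> P \<subseteq> cspan (F \<union> L)"
          using not_findim_quot_if_not_nest_f[OF P False L]
            findim_quotI[OF csubspace_nest[OF L(1)] that] by blast
        moreover have "closed_csubspace (cspan (F \<union> L))"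
          by (rule closed_csubspace_finite_Un[OF that closed_csubspace_nest[OF L(1)]])
        ultimately show ?thesis
          using src unfolding source_sequence_def by blast
      qed
      show "\<exists>m::nat. \<forall>k\<ge>m. P \<subseteq> K" if "K \<in> \<E>" "P \<subset> nest_plus \<E> K" for K
        using subset_if_psubset_nest_plus[OF P that] by blast
    qed
  next
    case True
    then have W_P: "\<exists>k\<ge>m. P \<subset> W k" for m
      using src by (simp add: source_sequence_def)
    then have "P \<noteq> UNIV"
      by blast
    then obtain Ns :: "nat \<Rightarrow> 'a set" where
      Ns: "\<And>k. Ns k \<in> \<E>" "\<And>k. Ns (Suc k) \<subset> Ns k" "\<Inter>(range Ns) = P"
      using decreasing_sequence_exists[OF P _ P_plus[rule_format, OF True]] by blast
    then have dec: "decseq Ns"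
      by (auto simp: decseq_Suc_iff)
    show thesis
    proof (rule that[of Ns])
      show "\<exists>j\<ge>m. \<not> W j \<inter> Ns k \<subseteq> cspan (F \<union> L)" if "finite F" for k m F
      proof -
        obtain j where j: "j \<ge> m" "P \<subset> W j"
          using W_P by blast
        have "P \<subset> Ns k"
          using Ns(2)[of k] Ns(3) by blast
        \<comment> \<open>The intersection is one of two nest elements strictly above the limit
          \<open>P\<close>, hence infinite dimensional modulo \<open>P\<close>, even where
          \<open>P/L\<close> is finite dimensional.\<close>
        then have "P \<subset> W j \<inter> Ns k"
          using j(2) nest_cases[OF W[of j] Ns(1)[of k]] by blast
        then have "\<not> findim_quot (W j \<inter> Ns k) P"
          using not_findim_quot_Inter[of Ns "W j \<inter> Ns k"] Ns nest_Int[OF W Ns(1)] by blast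
        moreover have "cspan (F \<union> L) \<subseteq> cspan (F \<union> P)"
          unfolding cspan_eq using L by (intro complex_vector.span_mono) auto
        ultimately have "\<not> W j \<inter> Ns k \<subseteq> cspan (F \<union> L)"
          using findim_quotI[OF csubspace_nest[OF P] that, of "W j \<inter> Ns k"] by blast
        then show ?thesis
          using j by blast
      qed
      show "\<exists>m. \<forall>k\<ge>m. Ns k \<subseteq> K" if K: "K \<in> \<E>" "P \<subset> nest_plus \<E> K" for K
      proof -
        \<comment> \<open>\<open>K = P\<close> is impossible because
          \<open>nest_plus \<E> P = P\<close>.\<close>
        have "P \<subset> K"
          using subset_if_psubset_nest_plus[OF P K] K(2) P_plus[rule_format, OF True] by blast
        then obtain m where "Ns m \<subset> K"
          using decreasing_cofinal[of Ns K] Ns K(1) by blast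
        then show ?thesis
          using decseqD[OF dec, of m] by blast
      qed
    qed
  qed
  \<comment> \<open>The last condition makes the indices strictly increasing, which keeps the
    functionals triangular along the subsequence.\<close>
  have "\<exists>a :: nat \<Rightarrow> 'a \<times> nat. \<forall>k. fst (a k) \<in> W (snd (a k)) \<inter> Z k
      \<and> fst (a k) \<notin> cspan (fst ` a ` {..<k} \<union> L) \<and> (\<forall>i\<in>snd ` a ` {..<k}. i < snd (a k))"
  proof (rule sequence_avoiding_previous)
    fix k and F :: "('a \<times> nat) set" assume F: "finite F"
    obtain m where m: "\<forall>i\<in>snd ` F. i < m"
      using F finite_nat_set_iff_bounded by (metis finite_imageI)
    obtain j x where "j \<ge> m" "x \<in> W j \<inter> Z k" "x \<notin> cspan (fst ` F \<union> L)"
      using avoid[of "fst ` F" m k] F by blast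
    then show "\<exists>a. fst a \<in> W (snd a) \<inter> Z k \<and> fst a \<notin> cspan (fst ` F \<union> L)
        \<and> (\<forall>i\<in>snd ` F. i < snd a)"
      using m by (intro exI[of _ "(x, j)"]) force
  qed
  then obtain a :: "nat \<Rightarrow> 'a \<times> nat" where a: "\<And>k. fst (a k) \<in> W (snd (a k)) \<inter> Z k"
    "\<And>k. fst (a k) \<notin> cspan (fst ` a ` {..<k} \<union> L)" "\<And>k. \<forall>i\<in>snd ` a ` {..<k}. i < snd (a k)"
    by blast
  define x j where "x k = fst (a k)" and "j k = snd (a k)" for k
  have "strict_mono j"
    using a(3) by (auto simp: strict_mono_def j_def)
  moreover have "x k \<in> W (j k) \<and> x k \<notin> cspan (x ` {..<k} \<union> L)" for k
    using a(1)[of k] a(2)[of k] by (simp add: x_def j_def image_image)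
  moreover have "\<exists>m. \<forall>k\<ge>m. x k \<in> K" if K: "K \<in> \<E>" "P \<subset> nest_plus \<E> K" for K
    using small[OF K] a(1) unfolding x_def by blast
  ultimately show ?thesis
    by blast
qed

section \<open>Assembly of the operator\<close>

lemma sums_image_findim_quot:
  assumes T: "\<And>z. (\<lambda>k. g k z *\<^sub>C x k) sums T z" and K: "K \<in> \<E>"
    and tail: "\<And>k z. k \<ge> m \<Longrightarrow> z \<in> N \<Longrightarrow> g k z *\<^sub>C x k \<in> K"
  shows "findim_quot (T ` N) K"
proof (rule findim_quotI)
  show "T ` N \<subseteq> cspan (x ` {..<m} \<union> K)"
  \<comment> \<open>The finite extension of \<open>K\<close> is closed, so it contains the sum of
    the series and not only its partial sums.\<close>
  proof (rule image_subsetI, rule closed_csubspace_sums[OF _ _ T])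
    show "closed_csubspace (cspan (x ` {..<m} \<union> K))"
      by (intro closed_csubspace_finite_Un closed_csubspace_nest K) simp
    fix z k assume "z \<in> N"
    show "g k z *\<^sub>C x k \<in> cspan (x ` {..<m} \<union> K)"
    proof (cases "k < m")
      case True
      then show ?thesis
        unfolding cspan_eq by (intro complex_vector.span_scale complex_vector.span_base) auto
    next
      case False
      then show ?thesis
        unfolding cspan_eq using tail[OF _ \<open>z \<in> N\<close>, of k]
        by (intro complex_vector.span_base) auto
    qed
  qed
qed (use K csubspace_nest in auto)

text \<open>Gives the lower bound for the essential support: by comparability, every
  \<open>L\<close> in the family defining \<open>supp_e_J\<close> must contain
  \<open>\<Psi> N\<close>.\<close>

lemma operator_not_findim_quot_exists:
  assumes N: "N \<in> \<E>" and L: "L \<in> \<E>" "L \<subset> \<Psi> N"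
  shows "\<exists>T\<in>M_Phi \<E> \<Phi> \<inter> M_e \<E> \<Psi>. \<not> findim_quot (T ` N) L"
proof -
  define P where "P = \<Psi> N"
  have P: "P \<in> \<E>" "P \<noteq> {0}"
    using Psi_in[OF N] L zero_in_nest[OF L(1)] by (auto simp: P_def)
  obtain V y W where src: "source_sequence P N V y W"
    using source_sequence_exists[OF P N] by (auto simp: P_def)
  then have V: "\<And>k. V k \<in> \<E>" and yN: "\<And>k. y k \<in> N" and y: "\<And>k. y k \<notin> cspan (y ` {..<k} \<union> V k)"
    and W: "\<And>k E. E \<in> \<E> \<Longrightarrow> E \<subseteq> V k \<or> W k \<subseteq> \<Phi> E"
    and eventually_V: "\<And>E. E \<in> \<E> \<Longrightarrow> \<not> P \<subseteq> \<Psi> E \<Longrightarrow> \<exists>m. \<forall>k\<ge>m. E \<subseteq> V k"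
    unfolding source_sequence_def by blast+
  have P_plus: "P \<in> nest_f \<E> \<longrightarrow> P = nest_plus \<E> P"
    using N pair unfolding P_def admissible_pair_def essential_support_function_def by blast
  obtain x :: "nat \<Rightarrow> 'a" and j where j: "strict_mono j" and xW: "\<And>k. x k \<in> W (j k)"
    and x: "\<And>k. x k \<notin> cspan (x ` {..<k} \<union> L)"
    and eventually_K: "\<And>K. K \<in> \<E> \<Longrightarrow> P \<subset> nest_plus \<E> K \<Longrightarrow> \<exists>m. \<forall>k\<ge>m. x k \<in> K"
    using target_sequence_exists[OF src P(1) L(1) L(2)[folded P_def] P_plus] by blast
  obtain f where f: "\<And>k. cfunctional (f k)" "\<And>k z. z \<in> V k \<Longrightarrow> f k z = 0" "\<And>k. f k (y k) = 1"
    "\<And>k n. n < k \<Longrightarrow> f k (y n) = 0"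
    using separating_functionals_exist[of V y] closed_csubspace_nest[OF V] y by blast
  obtain c T where c: "\<And>k. c k \<noteq> 0" and T: "bop T"
    and sums: "\<And>z. (\<lambda>k. (c k * f (j k) z) *\<^sub>C x k) sums T z"
    using nuclear_operator_exists[of "\<lambda>k. f (j k)" x] f(1) by blast
  have "T z \<in> \<Phi> E" if E: "E \<in> \<E>" and z: "z \<in> E" for E z
  proof (rule closed_csubspace_sums[OF closed_csubspace_nest[OF Phi_in[OF E]] _ sums])
    fix k
    consider "z \<in> V (j k)" | "x k \<in> \<Phi> E"
      using W[OF E, of "j k"] xW[of k] z by blast
    then show "(c k * f (j k) z) *\<^sub>C x k \<in> \<Phi> E"
    proof cases
      case 1
      then show ?thesis
        using f(2)[OF 1] zero_in_nest[OF Phi_in[OF E]] by simp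
    next
      case 2
      then show ?thesis
        using csubspace_nest[OF Phi_in[OF E]] by (simp add: csubspace_def)
    qed
  qed
  moreover have "findim_quot (T ` E) K"
    if E: "E \<in> \<E>" and K: "K \<in> \<E>" and EK: "\<Psi> E \<subset> nest_plus \<E> K" for E K
  \<comment> \<open>If \<open>P \<subseteq> \<Psi> E\<close>, the tail of the series has its vectors
    \<open>x k\<close> in \<open>K\<close>, whatever the functionals do; otherwise the tail
    functionals vanish on \<open>E\<close>.\<close>
  proof (cases "P \<subseteq> \<Psi> E")
    case True
    then obtain m where m: "\<forall>k\<ge>m. x k \<in> K"
      using eventually_K[OF K] EK by blast
    show ?thesis
    proof (rule sums_image_findim_quot[OF sums K])
      show "(c k * f (j k) z) *\<^sub>C x k \<in> K" if "k \<ge> m" for k z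
        using m that csubspace_nest[OF K] by (simp add: csubspace_def)
    qed
  next
    case False
    then obtain m where m: "\<forall>k\<ge>m. E \<subseteq> V k"
      using eventually_V[OF E] by blast
    show ?thesis
    proof (rule sums_image_findim_quot[OF sums K])
      show "(c k * f (j k) z) *\<^sub>C x k \<in> K" if "k \<ge> m" "z \<in> E" for k z
      proof -
        \<comment> \<open>A strictly increasing \<open>j\<close> satisfies
          \<open>j k \<ge> k\<close>, so the bound \<open>m\<close> also serves the
          subsequence.\<close>
        have "z \<in> V (j k)"
          using m that strict_mono_imp_increasing[OF j, of k] by (meson order_trans subsetD)
        then show ?thesis
          using f(2) zero_in_nest[OF K] by simp
      qed
    qed
  qed
  moreover have "\<not> findim_quot (T ` N) L"
  proof (rule not_findim_quotI[OF csubspace_nest[OF L(1)] _ x])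
    have TN: "complex_vector.subspace (T ` N)"
      using csubspace_bop_image[OF T csubspace_nest[OF N]] by (simp add: csubspace_eq)
    \<comment> \<open>Forward substitution: at \<open>y (j n)\<close> the series stops at the term
      with \<open>k = n\<close>, whose coefficient is \<open>c n\<close>, and the earlier
      \<open>x k\<close> are already in the image.\<close>
    show "x n \<in> T ` N" for n
    proof (induction n rule: less_induct)
      case (less n)
      let ?t = "\<lambda>k. (c k * f (j k) (y (j n))) *\<^sub>C x k"
      have "?t k = 0" if "k \<notin> {..n}" for k
        using that f(4)[of "j n" "j k"] j by (simp add: strict_mono_less)
      then have "?t sums (\<Sum>k\<in>{..n}. ?t k)"
        by (intro sums_finite) auto
      then have "T (y (j n)) = (\<Sum>k\<le>n. ?t k)"
        using sums_unique2[OF sums] by blast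
      also have "\<dots> = (\<Sum>k<n. ?t k) + c n *\<^sub>C x n"
        using f(3)[of "j n"] by (simp flip: lessThan_Suc_atMost)
      finally have "c n *\<^sub>C x n = T (y (j n)) - (\<Sum>k<n. ?t k)"
        by simp
      moreover have "(\<Sum>k<n. ?t k) \<in> T ` N"
        using less.IH by (intro complex_vector.subspace_sum[OF TN] complex_vector.subspace_scale[OF TN]) auto
      ultimately have "c n *\<^sub>C x n \<in> T ` N"
        using complex_vector.subspace_diff[OF TN] yN by simp
      then have "inverse (c n) *\<^sub>C (c n *\<^sub>C x n) \<in> T ` N"
        by (rule complex_vector.subspace_scale[OF TN])
      then show ?case
        using c[of n] by (simp add: cscale_cscale cscale_one)
    qed
  qed
  ultimately show ?thesis
    using T by (intro bexI[of _ T]) (auto simp: M_Phi_def M_e_def)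
qed

lemma supp_e_J_M_Phi_M_e:
  assumes N: "N \<in> \<E>"
  shows "supp_e_J \<E> (M_Phi \<E> \<Phi> \<inter> M_e \<E> \<Psi>) N = \<Psi> N"
proof
  show "supp_e_J \<E> (M_Phi \<E> \<Phi> \<inter> M_e \<E> \<Psi>) N \<subseteq> \<Psi> N"
    by (intro supp_e_J_M_e_subset N Psi_in) simp
  have "\<Psi> N \<subseteq> L"
    if L: "L \<in> \<E>" "\<forall>T\<in>M_Phi \<E> \<Phi> \<inter> M_e \<E> \<Psi>. findim_quot (T ` N) L" for L
    using nest_cases[OF Psi_in[OF N] L(1)] operator_not_findim_quot_exists[OF N L(1)] L(2) by blast
  then show "\<Psi> N \<subseteq> supp_e_J \<E> (M_Phi \<E> \<Phi> \<inter> M_e \<E> \<Psi>) N"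
    unfolding supp_e_J_def by blast
qed

end

theorem mainTheorem17:
  fixes \<E> :: "'a::cbanach set set"
    and \<Phi> \<Psi> :: "'a set \<Rightarrow> 'a set"
  assumes "nest \<E>" and "p_property \<E>" and "admissible_pair \<E> \<Phi> \<Psi>"
  shows "bimodule \<E> (M_Phi \<E> \<Phi> \<inter> M_e \<E> \<Psi>)
    \<and> (\<forall>E\<in>\<E>. supp_J (M_Phi \<E> \<Phi> \<inter> M_e \<E> \<Psi>) E = \<Phi> E
              \<and> supp_e_J \<E> (M_Phi \<E> \<Phi> \<inter> M_e \<E> \<Psi>) E = \<Psi> E)
    \<and> (\<forall>J. bimodule \<E> J \<and> (\<forall>E\<in>\<E>. supp_J J E = \<Phi> E \<and> supp_e_J \<E> J E = \<Psi> E)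
           \<longrightarrow> J \<subseteq> M_Phi \<E> \<Phi> \<inter> M_e \<E> \<Psi>)"
proof -
  interpret admissible_nest \<E> \<Phi> \<Psi>
    by unfold_locales (fact assms)+
  have "admissible \<E> \<Phi>" "\<Phi> {0} = {0}"
    using assms(3) by (simp_all add: admissible_pair_def)
  show ?thesis
  proof (intro conjI ballI allI impI)
    show "bimodule \<E> (M_Phi \<E> \<Phi> \<inter> M_e \<E> \<Psi>)"
      by (intro M_Phi_M_e_bimodule Phi_in)
    show "supp_J (M_Phi \<E> \<Phi> \<inter> M_e \<E> \<Psi>) E = \<Phi> E" if "E \<in> \<E>" for E
      by (rule supp_J_M_Phi_M_e) fact+
    show "supp_e_J \<E> (M_Phi \<E> \<Phi> \<inter> M_e \<E> \<Psi>) E = \<Psi> E" if "E \<in> \<E>" for E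
      by (rule supp_e_J_M_Phi_M_e) fact
    show "J \<subseteq> M_Phi \<E> \<Phi> \<inter> M_e \<E> \<Psi>"
      if "bimodule \<E> J \<and> (\<forall>E\<in>\<E>. supp_J J E = \<Phi> E \<and> supp_e_J \<E> J E = \<Psi> E)" for J
      using that by (intro bimodule_subset_M_Phi_M_e) (auto simp: bimodule_def)
  qed
qed

end
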